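(* In the variable-assignment setting, suppose that $\mathcal B$ satisfies Shearer's criterion. Let $i\in\{1,\dots,n\}$, let $D$ be a set of possible values of the variable $X(i)$, and let $A$ be the event $X(i)\in D$ (so $\mathrm{var}(A)=\{i\}$). Let $\mathcal B'$ be the set of bad-events $B\in\mathcal B[A]$ with $i\in\mathrm{var}(B)$, and let $\vee\mathcal B'=\bigcup_{B\in\mathcal B'}B$. Then $$\Pr_{\mathrm{MT}}(A)\ \le\ \Pr_\Omega(A)\Bigl(1+\Pr_\Omega(\vee\mathcal B')\cdot\max_{B\in\mathcal B'}\Psi_{\mathcal B[A]}(B)\Bigr)$$ (if $\mathcal B'=\emptyset$ the product on the right is read as $0$).
   Context: Variable-assignment setting: $\Omega$ is a product probability space with independent random variables $X(1),\dots,X(n)$. Every event $E$ considered is a boolean function of the variables in a specified subset $\mathrm{var}(E)\subseteq\{1,\dots,n\}$, and $E\sim E'$ means $\mathrm{var}(E)\cap\mathrm{var}(E')\ne\emptyset$. $\mathcal B$ is a finite collection of events (the bad-events). For an event $E$, $N(E)=\{B\in\mathcal B: B\sim E\}$ (for $B\in\mathcal B$ this is the inclusive neighborhood, so $B\in N(B)$). A set $I\subseteq\mathcal B$ is stable if no two distinct $B,B'\in I$ satisfy $B\sim B'$. For a subfamily $\mathcal C\subseteq\mathcal B$ and $I\subseteq\mathcal C$ let $$Q_{\mathcal C}(I)=\sum_{I\subseteq J\subseteq\mathcal C,\ J\text{ stable}}(-1)^{|J|-|I|}\prod_{B\in J}\Pr_\Omega(B).$$ Shearer's criterion for $\mathcal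 B$: $Q_{\mathcal B}(I)>0$ for all stable $I\subseteq\mathcal B$. (It is then also satisfied by every subfamily.) Under it, $\mu_{\mathcal C}(I)=Q_{\mathcal C}(I)/Q_{\mathcal C}(\emptyset)$ and, for an event $E$, $\Psi_{\mathcal C}(E)=\sum_{J\subseteq N(E)\cap\mathcal C}\mu_{\mathcal C}(J)$. For an event $E$, $\mathcal B[E]$ is the set of $B\in\mathcal B$ with $\Pr_\Omega(E\mid B)<1$. MT (Moser–Tardos) algorithm: draw $X\sim\Omega$; while some $B\in\mathcal B$ is true on $X$, choose some true $B\in\mathcal B$ (by an arbitrary fixed, possibly randomized, rule) and resample all variables in $\mathrm{var}(B)$ independently from their distributions in $\Omega$. Under Shearer's criterion it terminates with probability one. $\Pr_{\mathrm{MT}}$ denotes probability with respect to the distribution of $X$ at termination; the result holds for every choice of selection rule. *)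

theory Defs
  imports "HOL-Probability.Probability"
begin

(* An event comes with a designated set of variables that it may depend on. This set need not be
   the least possible one, and the same set of outcomes may occur with different variable sets. *)
datatype 'a event = Event (vars: "nat set") (outcomes: "(nat \<Rightarrow> 'a) set")

(* The values of the n variables; the j-th variable has distribution M j, and the variables
   are independent. *)
abbreviation config_space :: "nat \<Rightarrow> (nat \<Rightarrow> 'a measure) \<Rightarrow> (nat \<Rightarrow> 'a) measure" where
  "config_space n M \<equiv> PiM {1..n} M"

definition is_event :: "nat \<Rightarrow> (nat \<Rightarrow> 'a measure) \<Rightarrow> 'a event \<Rightarrow> bool" where
  "is_event n M E \<longleftrightarrow>
     vars E \<subseteq> {1..n} \<and>
     outcomes E \<in> sets (config_space n M) \<and>
     (\<forall>x \<in> space (config_space n M). \<forall>y \<in> space (config_space n M).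
        (\<forall>j \<in> vars E. x j = y j) \<longrightarrow> (x \<in> outcomes E \<longleftrightarrow> y \<in> outcomes E))"

definition dependent_events :: "'a event \<Rightarrow> 'a event \<Rightarrow> bool" where
  "dependent_events E E' \<longleftrightarrow> vars E \<inter> vars E' \<noteq> {}"

definition nbhd :: "'a event set \<Rightarrow> 'a event \<Rightarrow> 'a event set" where
  "nbhd Bs E = {B \<in> Bs. dependent_events B E}"

definition stable :: "'a event set \<Rightarrow> bool" where
  "stable I \<longleftrightarrow> pairwise (\<lambda>B B'. \<not> dependent_events B B') I"

definition pr :: "(nat \<Rightarrow> 'a) measure \<Rightarrow> 'a event \<Rightarrow> real" where
  "pr \<Omega> E = measure \<Omega> (outcomes E)"

definition shearer_Q :: "(nat \<Rightarrow> 'a) measure \<Rightarrow> 'a event set \<Rightarrow> 'a event set \<Rightarrow> real" where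
  "shearer_Q \<Omega> C I =
     (\<Sum>J | I \<subseteq> J \<and> J \<subseteq> C \<and> stable J. (-1) ^ (card J - card I) * (\<Prod>B\<in>J. pr \<Omega> B))"

definition shearer_criterion :: "(nat \<Rightarrow> 'a) measure \<Rightarrow> 'a event set \<Rightarrow> bool" where
  "shearer_criterion \<Omega> Bs \<longleftrightarrow> (\<forall>I. I \<subseteq> Bs \<and> stable I \<longrightarrow> shearer_Q \<Omega> Bs I > 0)"

definition shearer_mu :: "(nat \<Rightarrow> 'a) measure \<Rightarrow> 'a event set \<Rightarrow> 'a event set \<Rightarrow> real" where
  "shearer_mu \<Omega> C I = shearer_Q \<Omega> C I / shearer_Q \<Omega> C {}"

(* nbhd C E is N(E) intersected with C. *)
definition shearer_Psi :: "(nat \<Rightarrow> 'a) measure \<Rightarrow> 'a event set \<Rightarrow> 'a event \<Rightarrow> real" where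
  "shearer_Psi \<Omega> C E = (\<Sum>J \<in> Pow (nbhd C E). shearer_mu \<Omega> C J)"

(* Usually written B[E]. The library's cond_prob is 0 when conditioning on a null event;
   Shearer's criterion forces every bad-event to have positive probability. *)
definition not_forcing ::
    "(nat \<Rightarrow> 'a) measure \<Rightarrow> 'a event set \<Rightarrow> 'a event \<Rightarrow> 'a event set" where
  "not_forcing \<Omega> Bs E =
     {B \<in> Bs. cond_prob \<Omega> (\<lambda>x. x \<in> outcomes E) (\<lambda>x. x \<in> outcomes B) < 1}"

definition no_bad_event :: "'a event set \<Rightarrow> (nat \<Rightarrow> 'a) \<Rightarrow> bool" where
  "no_bad_event Bs x \<longleftrightarrow> (\<forall>B \<in> Bs. x \<notin> outcomes B)"

(* A run of the Moser-Tardos algorithm, as a process on a probability space P.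
   X t is the configuration after t resampling steps, sel t the bad-event chosen next, and
   Y t a fresh sample from the product distribution, from which the resampled variables are read.
   F t is everything that may influence the choice at time t: the history of the run and any
   private randomness of the selection rule. The process stays put once no bad-event is true,
   and the value of sel t is then irrelevant.
   Every (measurable) selection rule, possibly randomized and history-dependent, gives such a
   process: take P to be the space of the initial state, the samples Y t and the random seeds. *)
locale moser_tardos_run = prob_space P + filtration "space P" F
  for P :: "'w measure"
    and F :: "nat \<Rightarrow> 'w measure"
    and n :: nat
    and M :: "nat \<Rightarrow> 'a measure"
    and Bs :: "'a event set"
    and X :: "nat \<Rightarrow> 'w \<Rightarrow> nat \<Rightarrow> 'a"
    and sel :: "nat \<Rightarrow> 'w \<Rightarrow> 'a event"
    and Y :: "nat \<Rightarrow> 'w \<Rightarrow> nat \<Rightarrow> 'a" +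
  assumes subalgebra_F: "subalgebra P (F t)"
    and X_adapted: "X t \<in> F t \<rightarrow>\<^sub>M config_space n M"
    and sel_adapted: "sel t \<in> F t \<rightarrow>\<^sub>M count_space UNIV"
    and Y_measurable: "Y t \<in> P \<rightarrow>\<^sub>M config_space n M"
    and X_initial: "distr P (config_space n M) (X 0) = config_space n M"
    and Y_distr: "distr P (config_space n M) (Y t) = config_space n M"
    and Y_indep: "indep_set (sets (F t)) (sets (vimage_algebra (space P) (Y t) (config_space n M)))"
    and sel_true: "\<lbrakk>w \<in> space P; \<not> no_bad_event Bs (X t w)\<rbrakk>
                    \<Longrightarrow> sel t w \<in> Bs \<and> X t w \<in> outcomes (sel t w)"
    and X_step: "w \<in> space P \<Longrightarrow>
                  X (Suc t) w = (if no_bad_event Bs (X t w) then X t w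
                                 else override_on (X t w) (Y t w) (vars (sel t w)))"

(* The probability that the run terminates in a configuration where E is true. *)
definition pr_MT ::
    "'w measure \<Rightarrow> 'a event set \<Rightarrow> (nat \<Rightarrow> 'w \<Rightarrow> nat \<Rightarrow> 'a) \<Rightarrow> 'a event \<Rightarrow> real" where
  "pr_MT P Bs X E =
     measure P {w \<in> space P. \<exists>t. no_bad_event Bs (X t w) \<and> X t w \<in> outcomes E}"

end

theory Submission
  imports Defs
begin

text \<open>
  Stop the run when \<open>A\<close> becomes true. Either \<open>A\<close> is true initially, or it becomes true when the
  variable \<open>i\<close> is resampled on behalf of some \<open>B\<close> in \<open>B'\<close>, and the fresh value of \<open>i\<close> is independent
  of the history; all events resampled before are in \<open>B[A]\<close> up to a null set. The history is read off a
  table of independent values that holds one column for each variable. Omitting resamplings that do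
  not affect the current state of \<open>B\<close> leaves a history, encoded by a sequence of stable sets whose
  latest set is contained in \<open>N(B)\<close>, at whose end \<open>B\<close> is true and, by minimality, all earlier events of
  \<open>B'\<close> in a fixed enumeration are false. No resampling of \<open>i\<close> is omitted, since \<open>i\<close> is in
  \<open>var(B)\<close>. Hence the fresh value of \<open>i\<close> has the same place in the table, and a union bound applies:
  the weights of the sequences sum up to at most \<open>\<Psi>(B)\<close>, and the events \<open>B\<close> without the
  earlier ones are a partition of the union of \<open>B'\<close>.
\<close>

section \<open>Shearer's polynomials\<close>

text \<open>The selection rule is arbitrary, so histories cannot be summed over directly; stable set
  sequences forget the order of commuting resamplings, and their total weight does not depend on the
  rule. A union bound over the events \<open>B\<close> alone would give the sum of Pr(B) Psi(B); the
  probability of the union times a maximum is reached by passing to disjoint events. Dropping a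
  resampling restores older values of its variables and can make another event of \<open>B'\<close>
  true, so the choice of the least event is renewed after every drop. The disjoint event attached to
  \<open>B\<close> may read variables outside \<open>var(B)\<close>; this is harmless because the
  whole remaining table is fresh once a sequence has been checked. In the model the run is not
  driven by a table: the sample of a step is only known to be independent of the past, to which the
  rule adapts. The table is therefore rebuilt from the run at a finite time and padded with
  independent values. All estimates are made for a fixed time with a bound free of it, and the limit
  is taken last.\<close>

lemma dependent_events_commute: "dependent_events E E' \<longleftrightarrow> dependent_events E' E"
  by (auto simp: dependent_events_def)

lemma stable_subset: "stable J \<Longrightarrow> I \<subseteq> J \<Longrightarrow> stable I"
  unfolding stable_def by (rule pairwise_subset)

lemma shearer_Q_unstable: "\<not> stable J \<Longrightarrow> shearer_Q \<Omega> C J = 0"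
proof -
  assume "\<not> stable J"
  then have "{K. J \<subseteq> K \<and> K \<subseteq> C \<and> stable K} = {}"
    using stable_subset by blast
  then show ?thesis by (simp only: shearer_Q_def sum.empty)
qed

text \<open>A stable superset of \<open>J\<close> avoids \<open>b\<close> or contains it. Those of
  the second kind occur in both sums on the left with opposite signs, since \<open>card J\<close>
  and \<open>card (insert b J)\<close> differ by one.\<close>

lemma shearer_Q_delete:
  assumes "finite C" "b \<in> C" "J \<subseteq> C" "b \<notin> J"
  shows "shearer_Q \<Omega> C J + shearer_Q \<Omega> C (insert b J) = shearer_Q \<Omega> (C - {b}) J"
proof -
  let ?t = "\<lambda>J K. (-1) ^ (card K - card J) * (\<Prod>B\<in>K. pr \<Omega> B)"
  let ?U = "{K. J \<subseteq> K \<and> K \<subseteq> C - {b} \<and> stable K}"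
  let ?W = "{K. insert b J \<subseteq> K \<and> K \<subseteq> C \<and> stable K}"
  have fin: "finite ?U" "finite ?W"
    by (rule finite_subset[of _ "Pow C"]; use assms in auto)+
  have "{K. J \<subseteq> K \<and> K \<subseteq> C \<and> stable K} = ?U \<union> ?W" by blast
  then have "shearer_Q \<Omega> C J = sum (?t J) (?U \<union> ?W)"
    by (simp only: shearer_Q_def)
  moreover have "sum (?t J) (?U \<union> ?W) = sum (?t J) ?U + sum (?t J) ?W"
    by (rule sum.union_disjoint) (use fin in auto)
  moreover have "sum (?t J) ?W = - sum (?t (insert b J)) ?W"
    unfolding sum_negf[symmetric]
  proof (rule sum.cong)
    fix K assume "K \<in> ?W"
    then have K: "finite K" "insert b J \<subseteq> K" using assms(1) finite_subset[of K C] by auto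
    then have "card (insert b J) \<le> card K" by (rule card_mono)
    moreover have "finite J" using K finite_subset[of J K] by simp
    ultimately have "card K - card J = Suc (card K - card (insert b J))" using assms by simp
    then show "?t J K = - ?t (insert b J) K" by simp
  qed simp
  moreover have "shearer_Q \<Omega> C (insert b J) = sum (?t (insert b J)) ?W"
    "shearer_Q \<Omega> (C - {b}) J = sum (?t J) ?U"
    by (simp_all only: shearer_Q_def)
  ultimately show ?thesis by linarith
qed

lemma sum_Pow_insert:
  fixes f :: "'b set \<Rightarrow> real"
  assumes "finite S" "b \<notin> S"
  shows "sum f (Pow (insert b S)) = (\<Sum>J\<in>Pow S. f J + f (insert b J))"
proof -
  have "inj_on (insert b) (Pow S)" using assms by (auto simp: inj_on_def)
  moreover have "sum f (Pow (insert b S)) = sum f (Pow S) + sum f (insert b ` Pow S)"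
    unfolding Pow_insert by (rule sum.union_disjoint) (use assms in auto)
  ultimately show ?thesis by (simp add: sum.reindex sum.distrib)
qed

text \<open>Repeated deletion. If \<open>shearer_Q \<Omega> C J\<close> is thought of as the
  probability that exactly the events of \<open>J\<close> occur, both sides are the probability that
  no event of \<open>C - S\<close> occurs.\<close>

lemma sum_shearer_Q_Pow:
  assumes "finite C" "S \<subseteq> C"
  shows "(\<Sum>J\<in>Pow S. shearer_Q \<Omega> C J) = shearer_Q \<Omega> (C - S) {}"
proof -
  have "finite S" by (rule finite_subset[OF assms(2,1)])
  then show ?thesis using assms
  proof (induction S arbitrary: C)
    case (insert b S)
    have "(\<Sum>J\<in>Pow (insert b S). shearer_Q \<Omega> C J)
        = (\<Sum>J\<in>Pow S. shearer_Q \<Omega> C J + shearer_Q \<Omega> C (insert b J))"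
      using insert.hyps by (rule sum_Pow_insert)
    also have "\<dots> = (\<Sum>J\<in>Pow S. shearer_Q \<Omega> (C - {b}) J)"
      by (rule sum.cong) (use insert in \<open>auto intro!: shearer_Q_delete\<close>)
    also have "\<dots> = shearer_Q \<Omega> (C - {b} - S) {}"
      by (rule insert.IH) (use insert in auto)
    also have "C - {b} - S = C - insert b S" by blast
    finally show ?case .
  qed simp
qed

definition neighbours :: "'a event set \<Rightarrow> 'a event set" where
  "neighbours J = {B. \<exists>E\<in>J. dependent_events B E}"

text \<open>The stable supersets of \<open>J\<close> are the sets \<open>J \<union> L\<close> with
  \<open>L\<close> stable and free of neighbours of \<open>J\<close>, so the factor of
  \<open>J\<close> comes out. Nonempty variable sets make \<open>J\<close> part of its own
  neighbourhood, which keeps \<open>L\<close> disjoint from \<open>J\<close>.\<close>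

lemma shearer_Q_stable:
  assumes "finite C" "J \<subseteq> C" "stable J" "\<And>B. B \<in> C \<Longrightarrow> vars B \<noteq> {}"
  shows "shearer_Q \<Omega> C J = (\<Prod>B\<in>J. pr \<Omega> B) * shearer_Q \<Omega> (C - neighbours J) {}"
proof -
  have finJ: "finite J" by (rule finite_subset[OF assms(2,1)])
  have JN: "J \<subseteq> neighbours J"
  proof
    fix B assume B: "B \<in> J"
    then have "dependent_events B B"
      using assms(2,4) by (simp add: dependent_events_def subset_iff)
    then show "B \<in> neighbours J" using B unfolding neighbours_def by blast
  qed
  let ?L = "{L. {} \<subseteq> L \<and> L \<subseteq> C - neighbours J \<and> stable L}"
  have inj: "inj_on ((\<union>) J) ?L" 
  proof (rule inj_onI)
    fix L L' assume "L \<in> ?L" "L' \<in> ?L" "J \<union> L = J \<union> L'"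
    then show "L = L'" using JN by blast
  qed
  have im: "{K. J \<subseteq> K \<and> K \<subseteq> C \<and> stable K} = (\<union>) J ` ?L"
  proof (intro subset_antisym subsetI)
    fix K assume "K \<in> {K. J \<subseteq> K \<and> K \<subseteq> C \<and> stable K}"
    then have K: "J \<subseteq> K" "K \<subseteq> C" "stable K" by simp_all
    have "K - J \<subseteq> C - neighbours J"
    proof
      fix B assume B: "B \<in> K - J"
      have "\<not> dependent_events B E" if "E \<in> J" for E
      proof -
        have "B \<in> K" "E \<in> K" "B \<noteq> E" using B K(1) that by auto
        then show ?thesis using K(3) by (simp add: stable_def pairwise_def)
      qed
      then show "B \<in> C - neighbours J" using B K(2) by (auto simp: neighbours_def)
    qed
    moreover have "stable (K - J)" by (rule stable_subset[OF K(3)]) simp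
    moreover have "K = J \<union> (K - J)" using K by auto
    ultimately show "K \<in> (\<union>) J ` ?L" by (intro image_eqI) auto
  next
    fix K assume "K \<in> (\<union>) J ` ?L"
    then obtain L where L: "L \<subseteq> C - neighbours J" "stable L" "K = J \<union> L" by blast
    have "\<not> dependent_events B E" if "B \<in> J" "E \<in> L" for B E
      using L(1) that dependent_events_commute[of B E] by (auto simp: neighbours_def)
    moreover have "\<not> dependent_events E B" if "B \<in> J" "E \<in> L" for B E
      using L(1) that by (auto simp: neighbours_def)
    ultimately have "stable K"
      using L(2,3) \<open>stable J\<close> by (auto simp: stable_def pairwise_def)
    then show "K \<in> {K. J \<subseteq> K \<and> K \<subseteq> C \<and> stable K}"
      using L assms(2) by auto
  qed
  have "shearer_Q \<Omega> C J
      = (\<Sum>L\<in>?L. (-1) ^ (card (J \<union> L) - card J) * (\<Prod>B\<in>J \<union> L. pr \<Omega> B))"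
    unfolding shearer_Q_def im using inj by (simp add: sum.reindex)
  also have "\<dots> = (\<Sum>L\<in>?L. (\<Prod>B\<in>J. pr \<Omega> B) * ((-1) ^ (card L - card {}) * (\<Prod>B\<in>L. pr \<Omega> B)))"
  proof (rule sum.cong)
    fix L assume L: "L \<in> ?L"
    then have "finite L" "J \<inter> L = {}" using assms JN finite_subset[of L C] by auto
    then have "card (J \<union> L) - card J = card L"
       "(\<Prod>B\<in>J \<union> L. pr \<Omega> B) = (\<Prod>B\<in>J. pr \<Omega> B) * (\<Prod>B\<in>L. pr \<Omega> B)"
      using finJ by (simp_all add: card_Un_disjoint prod.union_disjoint)
    then show "(-1) ^ (card (J \<union> L) - card J) * (\<Prod>B\<in>J \<union> L. pr \<Omega> B)
       = (\<Prod>B\<in>J. pr \<Omega> B) * ((-1) ^ (card L - card {}) * (\<Prod>B\<in>L. pr \<Omega> B))" by simp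
  qed simp
  finally show ?thesis by (simp only: shearer_Q_def sum_distrib_left)
qed

lemma shearer_Q_nonneg:
  assumes "shearer_criterion \<Omega> Bs" "J \<subseteq> Bs"
  shows "0 \<le> shearer_Q \<Omega> Bs J"
proof (cases "stable J")
  case True
  then show ?thesis using assms by (simp add: shearer_criterion_def order_less_imp_le)
qed (simp add: shearer_Q_unstable)

text \<open>The sum over all \<open>J \<subseteq> Bs - C\<close> collapses to this value; it has no
  negative term and contains the positive one for the empty set.\<close>

lemma shearer_Q_empty_pos:
  assumes "finite Bs" "shearer_criterion \<Omega> Bs" "C \<subseteq> Bs"
  shows "0 < shearer_Q \<Omega> C {}"
proof -
  have "0 < shearer_Q \<Omega> Bs {}"
    using assms by (auto simp: shearer_criterion_def stable_def)
  also have "\<dots> = (\<Sum>J\<in>{{}}. shearer_Q \<Omega> Bs J)" by simp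
  also have "\<dots> \<le> (\<Sum>J\<in>Pow (Bs - C). shearer_Q \<Omega> Bs J)"
    by (rule sum_mono2) (use assms in \<open>auto intro!: shearer_Q_nonneg\<close>)
  also have "\<dots> = shearer_Q \<Omega> (Bs - (Bs - C)) {}"
    by (rule sum_shearer_Q_Pow) (use assms in auto)
  also have "Bs - (Bs - C) = C" using assms by auto
  finally show ?thesis .
qed

text \<open>Every term of \<open>shearer_Q \<Omega> Bs {B}\<close> contains the factor
  \<open>pr \<Omega> B\<close>.\<close>

lemma shearer_pr_pos:
  assumes "finite Bs" "shearer_criterion \<Omega> Bs" "B \<in> Bs"
  shows "pr \<Omega> B \<noteq> 0"
proof
  assume "pr \<Omega> B = 0"
  have "(-1) ^ (card J - card {B}) * (\<Prod>B\<in>J. pr \<Omega> B) = 0" if "{B} \<subseteq> J" "J \<subseteq> Bs" for J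
    using that \<open>pr \<Omega> B = 0\<close> finite_subset[OF that(2) assms(1)] by auto
  then have "shearer_Q \<Omega> Bs {B} = 0" unfolding shearer_Q_def by (intro sum.neutral) auto
  moreover have "0 < shearer_Q \<Omega> Bs {B}"
    using assms by (auto simp: shearer_criterion_def stable_def pairwise_def)
  ultimately show False by simp
qed

text \<open>An event without variables has probability 0 or 1; \<open>shearer_pr_pos\<close>
  excludes 0, and positivity of one minus its probability, which is the polynomial of the subfamily
  \<open>{B}\<close>, excludes 1. This is what makes every bad-event a neighbour of itself.\<close>

lemma shearer_vars_nonempty:
  assumes "finite Bs" "shearer_criterion (config_space n M) Bs" "B \<in> Bs" "is_event n M B"
    and "prob_space (config_space n M)"
  shows "vars B \<noteq> {}"
proof
  interpret prob_space "config_space n M" by fact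
  assume "vars B = {}"
  moreover have sub: "outcomes B \<subseteq> space (config_space n M)"
    using assms(4) sets.sets_into_space by (auto simp: is_event_def)
  ultimately have "outcomes B = {} \<or> outcomes B = space (config_space n M)"
    using assms(4) by (auto simp: is_event_def)
  moreover have p: "pr (config_space n M) B \<noteq> 0" using assms shearer_pr_pos by blast
  ultimately have p1: "pr (config_space n M) B = 1" using prob_space by (auto simp: pr_def)
  have "{J. {} \<subseteq> J \<and> J \<subseteq> {B} \<and> stable J} = {{}, {B}}"
    by (auto simp: stable_def)
  then have "shearer_Q (config_space n M) {B} {} = 0"
    unfolding shearer_Q_def using p1 by simp
  moreover have "0 < shearer_Q (config_space n M) {B} {}"
    using assms by (intro shearer_Q_empty_pos[of Bs]) auto
  ultimately show False by simp
qed

text \<open>The recursion that the weights of stable set sequences follow: the last level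
  \<open>J\<close> contributes its product, and the level before it lies among the neighbours of
  \<open>J\<close>.\<close>

lemma shearer_mu_stable:
  assumes "finite C" "J \<subseteq> C" "stable J" "\<And>B. B \<in> C \<Longrightarrow> vars B \<noteq> {}"
  shows "shearer_mu \<Omega> C J
    = (\<Prod>B\<in>J. pr \<Omega> B) * (\<Sum>I\<in>Pow (C \<inter> neighbours J). shearer_mu \<Omega> C I)"
proof -
  have "C - C \<inter> neighbours J = C - neighbours J" by auto
  then show ?thesis
    using sum_shearer_Q_Pow[of C "C \<inter> neighbours J" \<Omega>] shearer_Q_stable[OF assms, of \<Omega>] assms(1)
    unfolding shearer_mu_def sum_divide_distrib[symmetric] by simp
qed

section \<open>Stable set sequences and their total weight\<close>

fun top_level :: "'b set list \<Rightarrow> 'b set" where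
  "top_level [] = {}"
| "top_level (J # S) = J"

text \<open>In \<open>J # S\<close> the level \<open>J\<close> is later in time than
  \<open>S\<close>. The inclusion requires each event of a level to share a variable with an event
  of the next later level: nothing is recorded without an effect further on. The value of
  \<open>top_level []\<close> makes the condition void for the earliest level.\<close>

fun stable_seq :: "'a event set \<Rightarrow> 'a event set list \<Rightarrow> bool" where
  "stable_seq C [] \<longleftrightarrow> True"
| "stable_seq C (J # S) \<longleftrightarrow>
     J \<noteq> {} \<and> J \<subseteq> C \<and> stable J \<and> top_level S \<subseteq> neighbours J \<and> stable_seq C S"

definition seq_weight :: "(nat \<Rightarrow> 'a) measure \<Rightarrow> 'a event set list \<Rightarrow> real" where
  "seq_weight \<Omega> S = (\<Prod>J\<leftarrow>S. \<Prod>B\<in>J. pr \<Omega> B)"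

definition stable_seqs :: "'a event set \<Rightarrow> nat \<Rightarrow> 'a event set \<Rightarrow> 'a event set list set" where
  "stable_seqs C d K = {S. stable_seq C S \<and> length S \<le> d \<and> top_level S \<subseteq> K}"

lemma stable_seq_memD: "stable_seq C S \<Longrightarrow> J \<in> set S \<Longrightarrow> J \<subseteq> C \<and> stable J"
  by (induction S) auto

lemma finite_stable_seqs: "finite C \<Longrightarrow> finite (stable_seqs C d K)"
  by (rule finite_subset[OF _ finite_lists_length_le[of "Pow C" d]])
    (auto simp: stable_seqs_def dest: stable_seq_memD)

text \<open>Induction on the length bound. The empty sequence has weight 1, which is
  \<open>shearer_mu \<Omega> C {}\<close>. Cutting off the last level \<open>J\<close> leaves a
  sequence with top level in \<open>C \<inter> neighbours J\<close>, so by
  \<open>shearer_mu_stable\<close> the sequences with top level \<open>J\<close> add up to at most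
  \<open>shearer_mu \<Omega> C J\<close>, whatever \<open>d\<close> is.\<close>

lemma sum_seq_weight_le:
  assumes "finite C" "\<And>B. B \<in> C \<Longrightarrow> vars B \<noteq> {}" "K \<subseteq> C" "shearer_Q \<Omega> C {} > 0"
    and nonneg: "\<And>J. J \<subseteq> C \<Longrightarrow> 0 \<le> shearer_mu \<Omega> C J"
  shows "(\<Sum>S\<in>stable_seqs C d K. seq_weight \<Omega> S) \<le> (\<Sum>J\<in>Pow K. shearer_mu \<Omega> C J)"
  using \<open>K \<subseteq> C\<close>
proof (induction d arbitrary: K)
  case 0
  have "finite K" by (rule finite_subset[OF 0 assms(1)])
  have "stable_seqs C 0 K = {[]}" by (auto simp: stable_seqs_def)
  then have "(\<Sum>S\<in>stable_seqs C 0 K. seq_weight \<Omega> S) = (\<Sum>J\<in>{{}}. shearer_mu \<Omega> C J)"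
    using assms by (simp add: seq_weight_def shearer_mu_def)
  also have "\<dots> \<le> (\<Sum>J\<in>Pow K. shearer_mu \<Omega> C J)"
    by (rule sum_mono2) (use 0 nonneg \<open>finite K\<close> in auto)
  finally show ?case .
next
  case (Suc d)
  have finK: "finite K" by (rule finite_subset[OF Suc.prems assms(1)])
  let ?I = "{J. J \<noteq> {} \<and> J \<subseteq> K \<and> stable J}"
  let ?T = "\<lambda>J. stable_seqs C d (C \<inter> neighbours J)"
  have finI: "finite ?I" by (rule finite_subset[of _ "Pow K"]) (use finK in auto)
  have "stable_seqs C (Suc d) K = insert [] (\<Union>J\<in>?I. (#) J ` ?T J)"
  proof (rule set_eqI)
    fix S show "S \<in> stable_seqs C (Suc d) K \<longleftrightarrow> S \<in> insert [] (\<Union>J\<in>?I. (#) J ` ?T J)"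
    proof (cases S)
      case (Cons J S')
      have "stable_seq C S' \<Longrightarrow> top_level S' \<subseteq> C" by (cases S') auto
      then show ?thesis using Cons Suc.prems by (auto simp: stable_seqs_def)
    qed (simp add: stable_seqs_def)
  qed
  then have split: "(\<Sum>S\<in>stable_seqs C (Suc d) K. seq_weight \<Omega> S)
    = seq_weight \<Omega> [] + (\<Sum>S\<in>(\<Union>J\<in>?I. (#) J ` ?T J). seq_weight \<Omega> S)"
    using finI finite_stable_seqs[OF assms(1)] by (simp add: sum.insert image_iff)
  have "(\<Sum>S\<in>(\<Union>J\<in>?I. (#) J ` ?T J). seq_weight \<Omega> S)
    = (\<Sum>J\<in>?I. \<Sum>S\<in>(#) J ` ?T J. seq_weight \<Omega> S)"
    by (rule sum.UNION_disjoint) (use finI finite_stable_seqs[OF assms(1)] in auto)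
  also have "\<dots> = (\<Sum>J\<in>?I. (\<Prod>B\<in>J. pr \<Omega> B) * (\<Sum>S\<in>?T J. seq_weight \<Omega> S))"
    by (simp add: sum.reindex seq_weight_def sum_distrib_left)
  also have "\<dots> \<le> (\<Sum>J\<in>?I. (\<Prod>B\<in>J. pr \<Omega> B) * (\<Sum>I\<in>Pow (C \<inter> neighbours J). shearer_mu \<Omega> C I))"
    by (intro sum_mono mult_left_mono Suc.IH prod_nonneg) (auto simp: pr_def)
  also have "\<dots> = (\<Sum>J\<in>?I. shearer_mu \<Omega> C J)"
  proof (rule sum.cong)
    fix J assume J: "J \<in> ?I"
    then have "J \<subseteq> C" using Suc.prems by auto
    then show "(\<Prod>B\<in>J. pr \<Omega> B) * (\<Sum>I\<in>Pow (C \<inter> neighbours J). shearer_mu \<Omega> C I)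
      = shearer_mu \<Omega> C J"
      using J by (intro shearer_mu_stable[symmetric]) (simp_all add: assms(1,2))
  qed simp
  finally have "(\<Sum>S\<in>(\<Union>J\<in>?I. (#) J ` ?T J). seq_weight \<Omega> S)
    \<le> (\<Sum>J\<in>?I. shearer_mu \<Omega> C J)" .
  moreover have "seq_weight \<Omega> [] + (\<Sum>J\<in>?I. shearer_mu \<Omega> C J) = (\<Sum>J\<in>insert {} ?I. shearer_mu \<Omega> C J)"
    using assms finI by (simp add: seq_weight_def shearer_mu_def)
  moreover have "\<dots> \<le> (\<Sum>J\<in>Pow K. shearer_mu \<Omega> C J)"
    by (rule sum_mono2) (use Suc.prems nonneg finK in auto)
  ultimately show ?case using split by linarith
qed

section \<open>Resampling tables and stable set sequences\<close>

lemma event_cong: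
  assumes "is_event n M E" "x \<in> space (config_space n M)" "y \<in> space (config_space n M)"
    and "\<And>j. j \<in> vars E \<Longrightarrow> x j = y j"
  shows "x \<in> outcomes E \<longleftrightarrow> y \<in> outcomes E"
  using assms unfolding is_event_def by blast

locale resampling_table =
  fixes n :: nat and M :: "nat \<Rightarrow> 'a measure"
  assumes prob_space_M: "j \<in> {1..n} \<Longrightarrow> prob_space (M j)"
begin

declare One_nat_def [simp del]

abbreviation configs :: "(nat \<Rightarrow> 'a) measure" where
  "configs \<equiv> config_space n M"

abbreviation tables :: "(nat \<times> nat \<Rightarrow> 'a) measure" where
  "tables \<equiv> PiM ({1..n} \<times> UNIV) (\<lambda>p. M (fst p))"

text \<open>In a table \<open>R\<close> the entries \<open>R (v, 0)\<close>, \<open>R (v, 1)\<close>, \<dots> are the current and the future values of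
  the variable \<open>v\<close>, in the order in which they are drawn.\<close>

definition head :: "(nat \<times> nat \<Rightarrow> 'a) \<Rightarrow> nat \<Rightarrow> 'a" where
  "head R = (\<lambda>v\<in>{1..n}. R (v, 0))"

definition advance :: "nat set \<Rightarrow> (nat \<times> nat \<Rightarrow> 'a) \<Rightarrow> nat \<times> nat \<Rightarrow> 'a" where
  "advance V R = (\<lambda>(v, k)\<in>{1..n} \<times> UNIV. R (v, if v \<in> V then Suc k else k))"

text \<open>A right inverse of \<open>advance V\<close>, with \<open>x\<close> as the new top
  entries. It serves both to put discarded values back and to build a random table from fresh
  values.\<close>

definition splice :: "nat set \<Rightarrow> (nat \<Rightarrow> 'a) \<Rightarrow> (nat \<times> nat \<Rightarrow> 'a) \<Rightarrow> nat \<times> nat \<Rightarrow> 'a" where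
  "splice V x R = (\<lambda>(v, k)\<in>{1..n} \<times> UNIV.
     if v \<in> V then (case k of 0 \<Rightarrow> x v | Suc j \<Rightarrow> R (v, j)) else R (v, k))"

lemma head_apply: "v \<in> {1..n} \<Longrightarrow> head R v = R (v, 0)"
  by (simp add: head_def)

lemma advance_apply:
  "v \<in> {1..n} \<Longrightarrow> advance V R (v, k) = R (v, if v \<in> V then Suc k else k)"
  by (simp add: advance_def)

lemma splice_apply:
  "v \<in> {1..n} \<Longrightarrow> splice V x R (v, k) =
     (if v \<in> V then (case k of 0 \<Rightarrow> x v | Suc j \<Rightarrow> R (v, j)) else R (v, k))"
  by (simp add: splice_def)

lemma table_eqI:
  assumes "R \<in> extensional ({1..n} \<times> UNIV)" "R' \<in> extensional ({1..n} \<times> UNIV)"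
    and "\<And>v k. v \<in> {1..n} \<Longrightarrow> R (v, k) = R' (v, k)"
  shows "R = R'"
  by (rule extensionalityI[OF assms(1,2)]) (use assms(3) in auto)

lemma config_eqI:
  assumes "x \<in> extensional {1..n}" "y \<in> extensional {1..n}"
    and "\<And>v. v \<in> {1..n} \<Longrightarrow> x v = y v"
  shows "x = y"
  using assms by (rule extensionalityI)

lemma extensional_table:
  "head R \<in> extensional {1..n}"
  "advance V R \<in> extensional ({1..n} \<times> UNIV)"
  "splice V x R \<in> extensional ({1..n} \<times> UNIV)"
  by (simp_all add: head_def advance_def splice_def)

lemma space_extensional:
  "R \<in> space tables \<Longrightarrow> R \<in> extensional ({1..n} \<times> UNIV)"
  "x \<in> space configs \<Longrightarrow> x \<in> extensional {1..n}"
  by (simp_all add: space_PiM PiE_def)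

lemma head_space: "R \<in> space tables \<Longrightarrow> head R \<in> space configs"
  by (auto simp: head_def space_PiM PiE_iff)

lemma advance_space: "R \<in> space tables \<Longrightarrow> advance V R \<in> space tables"
  by (auto simp: advance_def space_PiM PiE_iff)

lemma splice_space:
  "x \<in> space configs \<Longrightarrow> R \<in> space tables \<Longrightarrow> splice V x R \<in> space tables"
  by (auto simp: splice_def space_PiM PiE_iff split: nat.split)

lemma advance_commute: "advance V (advance W R) = advance W (advance V R)"
  by (rule table_eqI) (simp_all add: extensional_table advance_apply)

lemma advance_Un:
  "V \<inter> W = {} \<Longrightarrow> advance (V \<union> W) R = advance V (advance W R)"
  by (rule table_eqI) (auto simp: extensional_table advance_apply)

lemma head_advance:
  "v \<in> {1..n} \<Longrightarrow> v \<notin> V \<Longrightarrow> head (advance V R) v = head R v"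
  by (simp add: head_apply advance_apply)

lemma advance_splice: "R \<in> space tables \<Longrightarrow> advance V (splice V x R) = R"
  by (rule table_eqI) (simp_all add: extensional_table space_extensional advance_apply splice_apply)

fun run_table :: "'a event list \<Rightarrow> (nat \<times> nat \<Rightarrow> 'a) \<Rightarrow> nat \<times> nat \<Rightarrow> 'a" where
  "run_table [] R = R"
| "run_table (B # h) R = run_table h (advance (vars B) R)"

fun run_ok :: "'a event list \<Rightarrow> (nat \<times> nat \<Rightarrow> 'a) \<Rightarrow> bool" where
  "run_ok [] R \<longleftrightarrow> True"
| "run_ok (B # h) R \<longleftrightarrow> head R \<in> outcomes B \<and> run_ok h (advance (vars B) R)"

text \<open>
  A stable set sequence lists its levels in reverse order of time, so that its first level
  consists of the events that are resampled last.
\<close>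

fun seq_table :: "'a event set list \<Rightarrow> (nat \<times> nat \<Rightarrow> 'a) \<Rightarrow> nat \<times> nat \<Rightarrow> 'a" where
  "seq_table [] R = R"
| "seq_table (J # S) R = advance (\<Union>(vars ` J)) (seq_table S R)"

fun seq_ok :: "'a event set list \<Rightarrow> (nat \<times> nat \<Rightarrow> 'a) \<Rightarrow> bool" where
  "seq_ok [] R \<longleftrightarrow> True"
| "seq_ok (J # S) R \<longleftrightarrow> seq_ok S R \<and> (\<forall>B\<in>J. head (seq_table S R) \<in> outcomes B)"

section \<open>Sorting a history into levels\<close>

definition touches :: "'a event \<Rightarrow> 'a event set list \<Rightarrow> bool" where
  "touches B S \<longleftrightarrow> (\<exists>J\<in>set S. \<exists>E\<in>J. dependent_events B E)"

text \<open>In time, \<open>B\<close> precedes everything in \<open>S\<close>. It is moved to the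
  latest level such that neither that level nor an earlier one touches \<open>B\<close>. The next
  later level, if there is one, then contains an event dependent on \<open>B\<close>, as
  \<open>stable_seq\<close> demands.\<close>

fun insert_first :: "'a event \<Rightarrow> 'a event set list \<Rightarrow> 'a event set list" where
  "insert_first B [] = [{B}]"
| "insert_first B (J # S) =
     (if touches B (J # S) then J # insert_first B S else insert B J # S)"

text \<open>\<open>foldr\<close> starts with the last resampling, so each event is placed among
  those that follow it.\<close>

definition levels :: "'a event list \<Rightarrow> 'a event set list" where
  "levels h = foldr insert_first h []"

lemma levels_simps [simp]: "levels [] = []" "levels (B # h) = insert_first B (levels h)"
  by (simp_all add: levels_def)

lemma seq_table_space: "R \<in> space tables \<Longrightarrow> seq_table S R \<in> space tables"
  by (induction S) (auto intro: advance_space)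

lemma run_table_space: "R \<in> space tables \<Longrightarrow> run_table h R \<in> space tables"
  by (induction h arbitrary: R) (auto intro: advance_space)

lemma seq_table_advance: "seq_table S (advance V R) = advance V (seq_table S R)"
  by (induction S) (simp_all add: advance_commute)

lemma run_table_advance: "run_table h (advance V R) = advance V (run_table h R)"
proof (induction h arbitrary: R)
  case (Cons B h)
  then show ?case using advance_commute by simp
qed simp

lemma run_table_append: "run_table (h @ h') R = run_table h' (run_table h R)"
  by (induction h arbitrary: R) simp_all

lemma run_ok_append: "run_ok (h @ h') R \<longleftrightarrow> run_ok h R \<and> run_ok h' (run_table h R)"
  by (induction h arbitrary: R) simp_all

text \<open>Used to cancel a resampling: events that do not read the columns in \<open>V\<close>
  cannot notice whether these have been advanced.\<close>

lemma run_ok_advance: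
  assumes "\<And>E. E \<in> set h \<Longrightarrow> is_event n M E" "\<And>E. E \<in> set h \<Longrightarrow> vars E \<inter> V = {}"
    and "R \<in> space tables" "run_ok h (advance V R)"
  shows "run_ok h R"
  using assms
proof (induction h arbitrary: R)
  case (Cons B h)
  have B: "is_event n M B" "vars B \<inter> V = {}" using Cons.prems by auto
  have "head (advance V R) v = head R v" if "v \<in> vars B" for v
    using that B by (intro head_advance) (auto simp: is_event_def)
  then have "head (advance V R) \<in> outcomes B \<longleftrightarrow> head R \<in> outcomes B"
    using Cons.prems(3) by (intro event_cong[OF B(1)] head_space advance_space)
  moreover have "run_ok h (advance (vars B) R)"
  proof (rule Cons.IH)
    show "run_ok h (advance V (advance (vars B) R))"
      using Cons.prems(4) advance_commute by simp
  qed (use Cons.prems in \<open>auto intro: advance_space\<close>)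
  ultimately show ?case using Cons.prems(4) by simp
qed simp

lemma seq_ok_advance:
  assumes "\<And>J E. J \<in> set S \<Longrightarrow> E \<in> J \<Longrightarrow> is_event n M E \<and> vars E \<inter> V = {}"
    and "R \<in> space tables" "seq_ok S (advance V R)"
  shows "seq_ok S R"
  using assms(1,3)
proof (induction S)
  case (Cons J S)
  have "head (seq_table S R) \<in> outcomes E" if "E \<in> J" for E
  proof -
    have E: "is_event n M E" "vars E \<inter> V = {}" using Cons.prems(1)[of J E] that by auto
    have "head (advance V (seq_table S R)) v = head (seq_table S R) v" if "v \<in> vars E" for v
      using that E by (intro head_advance) (auto simp: is_event_def)
    then have "head (advance V (seq_table S R)) \<in> outcomes E \<longleftrightarrow> head (seq_table S R) \<in> outcomes E"
      using assms(2) by (intro event_cong[OF E(1)] head_space advance_space seq_table_space)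
    then show ?thesis using Cons.prems(2) that by (simp add: seq_table_advance)
  qed
  moreover have "seq_ok S R" using Cons.prems by (intro Cons.IH) auto
  ultimately show ?case by simp
qed simp

lemma seq_table_untouched:
  assumes "v \<in> {1..n}" "\<And>J E. J \<in> set S \<Longrightarrow> E \<in> J \<Longrightarrow> v \<notin> vars E"
  shows "seq_table S R (v, k) = R (v, k)"
  using assms(2)
proof (induction S)
  case (Cons J S)
  then have "v \<notin> \<Union>(vars ` J)" by auto
  moreover have "seq_table S R (v, k) = R (v, k)"
    by (rule Cons.IH) (use Cons.prems in auto)
  ultimately show ?case using assms(1) by (simp add: advance_apply)
qed simp

text \<open>Only the number of advances of each column counts, not their order. When
  \<open>B\<close> joins the level \<open>J\<close>, the variable sets are disjoint, so no column is
  advanced once instead of twice.\<close>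

lemma seq_table_insert_first:
  "seq_table (insert_first B S) R = advance (vars B) (seq_table S R)"
proof (induction S)
  case (Cons J S)
  show ?case
  proof (cases "touches B (J # S)")
    case True
    then show ?thesis using Cons by (simp add: advance_commute)
  next
    case False
    then have "vars B \<inter> \<Union>(vars ` J) = {}" by (auto simp: touches_def dependent_events_def)
    then show ?thesis using False by (simp add: advance_Un)
  qed
qed simp

text \<open>Moving \<open>B\<close> past other levels is harmless on both sides: the events that it
  passes do not read its columns, and its own columns are still unchanged when its new level is
  reached.\<close>

lemma seq_ok_insert_first:
  assumes "is_event n M B" "\<And>J E. J \<in> set S \<Longrightarrow> E \<in> J \<Longrightarrow> is_event n M E"
    and "R \<in> space tables" "head R \<in> outcomes B" "seq_ok S (advance (vars B) R)"
  shows "seq_ok (insert_first B S) R"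
  using assms(2,5)
proof (induction S)
  case (Cons J S)
  show ?case
  proof (cases "touches B (J # S)")
    case True
    moreover have "seq_ok (insert_first B S) R"
      by (rule Cons.IH) (use Cons.prems in auto)
    ultimately show ?thesis
      using Cons.prems(2) by (simp add: seq_table_insert_first seq_table_advance)
  next
    case False
    have ind: "vars E \<inter> vars B = {}" if "J' \<in> set (J # S)" "E \<in> J'" for J' E
      using False that by (auto simp: touches_def dependent_events_def)
    have "seq_ok (J # S) R"
      by (rule seq_ok_advance[OF _ assms(3) Cons.prems(2)]) (use ind Cons.prems(1) in auto)
    moreover have "head (seq_table S R) \<in> outcomes B"
    proof -
      have "head (seq_table S R) v = head R v" if v: "v \<in> vars B" for v
      proof -
        have vn: "v \<in> {1..n}" using v assms(1) by (auto simp: is_event_def)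
        have "seq_table S R (v, 0) = R (v, 0)"
          by (rule seq_table_untouched[OF vn]) (use v ind in auto)
        then show ?thesis by (simp add: head_apply[OF vn])
      qed
      then have "head (seq_table S R) \<in> outcomes B \<longleftrightarrow> head R \<in> outcomes B"
        using assms(3) by (intro event_cong[OF assms(1)] head_space seq_table_space)
      then show ?thesis using assms(4) by simp
    qed
    ultimately show ?thesis using False by simp
  qed
qed (use assms(4) in simp)

lemma Union_insert_first: "\<Union>(set (insert_first B S)) = insert B (\<Union>(set S))"
  by (induction S) auto

lemma Union_levels: "\<Union>(set (levels h)) = set h"
  by (induction h) (simp_all add: Union_insert_first)

lemma length_insert_first: "length (insert_first B S) \<le> Suc (length S)"
  by (induction S) auto

lemma length_levels: "length (levels h) \<le> length h"
proof (induction h)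
  case (Cons B h)
  then show ?case using length_insert_first[of B "levels h"] by simp
qed simp

lemma top_level_insert_first:
  "top_level (insert_first B S) = (if touches B S then top_level S else insert B (top_level S))"
  by (cases S) (auto simp: touches_def)

lemma stable_seq_insert_first:
  assumes "stable_seq C S" "B \<in> C"
  shows "stable_seq C (insert_first B S)"
  using assms(1)
proof (induction S)
  case Nil
  then show ?case using assms(2) by (simp add: stable_def)
next
  case (Cons J S)
  show ?case
  proof (cases "touches B (J # S)")
    case True
    have "top_level (insert_first B S) \<subseteq> neighbours J"
      using Cons.prems True
      by (auto simp: top_level_insert_first touches_def neighbours_def)
    then show ?thesis using True Cons by simp
  next
    case False
    then have "\<not> dependent_events B E" "\<not> dependent_events E B" if "E \<in> J" for E
      using that dependent_events_commute[of B E] by (auto simp: touches_def)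
    then have "stable (insert B J)"
      using Cons.prems by (auto simp: stable_def pairwise_def)
    then show ?thesis using False Cons.prems assms(2) by (auto simp: neighbours_def)
  qed
qed

lemma stable_seq_levels: "set h \<subseteq> C \<Longrightarrow> stable_seq C (levels h)"
  by (induction h) (simp_all add: stable_seq_insert_first)

lemma seq_table_levels: "seq_table (levels h) R = run_table h R"
  by (induction h) (simp_all add: seq_table_insert_first run_table_advance)

lemma seq_ok_levels:
  assumes "\<And>E. E \<in> set h \<Longrightarrow> is_event n M E" "R \<in> space tables" "run_ok h R"
  shows "seq_ok (levels h) R"
  using assms
proof (induction h arbitrary: R)
  case (Cons B h)
  have ev: "is_event n M E" if "J \<in> set (levels h)" "E \<in> J" for J E
  proof -
    have "E \<in> set h" using that Union_levels[of h] by auto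
    then show ?thesis using Cons.prems(1) by simp
  qed
  have "seq_ok (levels h) (advance (vars B) R)"
    using Cons.prems by (intro Cons.IH) (auto intro: advance_space)
  then show ?case
    using Cons.prems ev by (simp add: seq_ok_insert_first)
qed simp

text \<open>An event enters the last level only if it touches nothing that follows it. Such a
  resampling commutes to the end of the history, which makes it a candidate for removal.\<close>

lemma top_level_levels:
  assumes "E \<in> top_level (levels h)"
  shows "\<exists>h1 h2. h = h1 @ E # h2 \<and> (\<forall>E'\<in>set h2. \<not> dependent_events E E')"
  using assms
proof (induction h)
  case (Cons B h)
  show ?case
  proof (cases "E \<in> top_level (levels h)")
    case True
    then obtain h1 h2 where "h = h1 @ E # h2" "\<forall>E'\<in>set h2. \<not> dependent_events E E'"
      using Cons.IH by blast
    then have "B # h = (B # h1) @ E # h2 \<and> (\<forall>E'\<in>set h2. \<not> dependent_events E E')" by simp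
    then show ?thesis by blast
  next
    case False
    then have "E = B" "\<not> touches B (levels h)"
      using Cons.prems by (auto simp: top_level_insert_first split: if_splits)
    moreover from this have "\<not> dependent_events B E'" if "E' \<in> set h" for E'
      using that Union_levels[of h] by (auto simp: touches_def)
    ultimately have "B # h = [] @ E # h \<and> (\<forall>E'\<in>set h. \<not> dependent_events E E')" by simp
    then show ?thesis by blast
  qed
qed simp

text \<open>
  As long as the run contains a last resampling that does not interact with the event \<open>B\<close> of
  least rank that holds at its end, it can be dropped without affecting \<open>B\<close>.
\<close>

lemma minimal_witness:
  fixes rank :: "'a event \<Rightarrow> nat"
  assumes "\<And>E. E \<in> C \<Longrightarrow> is_event n M E" "K \<subseteq> C" "finite K" "\<And>B. B \<in> K \<Longrightarrow> i \<in> vars B"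
    and "R \<in> space tables" "set h \<subseteq> C" "run_ok h R" "length h \<le> d"
    and "B \<in> K" "head (run_table h R) \<in> outcomes B"
  shows "\<exists>B\<in>K. \<exists>S\<in>stable_seqs C d (nbhd C B). seq_ok S R \<and>
    head (seq_table S R) \<in> outcomes B - (\<Union>E\<in>{E \<in> K. rank E < rank B}. outcomes E) \<and>
    (\<forall>k. seq_table S R (i, k) = run_table h R (i, k))"
  using assms(6-)
proof (induction "length h" arbitrary: h B rule: less_induct)
  case less
  let ?L = "{B \<in> K. head (run_table h R) \<in> outcomes B}"
  \<comment> \<open>The given \<open>B\<close> only shows that some event of \<open>K\<close> is
    true at the end; the one of least rank takes its place.\<close>
  obtain B1 where B1: "B1 \<in> ?L" "\<And>E. E \<in> ?L \<Longrightarrow> rank B1 \<le> rank E"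
    using ex_has_least_nat[of "\<lambda>E. E \<in> ?L" B rank] less.prems(4,5) by blast
  have first: "head (run_table h R) \<in> outcomes B1 - (\<Union>E\<in>{E \<in> K. rank E < rank B1}. outcomes E)"
    using B1 by (auto simp: not_less[symmetric])
  show ?case
  proof (cases "top_level (levels h) \<subseteq> nbhd C B1")
    case True
    have "levels h \<in> stable_seqs C d (nbhd C B1)"
      using True less.prems length_levels[of h]
      by (auto simp: stable_seqs_def stable_seq_levels)
    moreover have "seq_ok (levels h) R"
      using less.prems assms by (intro seq_ok_levels) auto
    ultimately show ?thesis using B1 first
      by (intro bexI[of _ B1] bexI[of _ "levels h"]) (simp_all add: seq_table_levels)
  next
    case False
    then obtain E where E: "E \<in> top_level (levels h)" "E \<notin> nbhd C B1" by blast
    obtain h1 h2 where h: "h = h1 @ E # h2" and h2: "\<And>E'. E' \<in> set h2 \<Longrightarrow> \<not> dependent_events E E'"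
      using top_level_levels[OF E(1)] by blast
    have EB: "vars E \<inter> vars B1 = {}"
      using E(2) h less.prems(1) by (auto simp: nbhd_def dependent_events_def)
    \<comment> \<open>\<open>E\<close> commutes with \<open>h2\<close> and shares no variable with
      \<open>B1\<close>, so its resampling can be erased: \<open>B1\<close> stays true, and column
      \<open>i\<close>, which belongs to \<open>B1\<close>, does not shift. Afterwards
      \<open>B1\<close> may no longer be of least rank; the induction hypothesis chooses
      anew.\<close>
    let ?h = "h1 @ h2"
    have tab: "run_table h R = advance (vars E) (run_table ?h R)"
      by (simp add: h run_table_append run_table_advance)
    have "run_ok h2 (run_table h1 R)"
    proof (rule run_ok_advance)
      show "run_ok h2 (advance (vars E) (run_table h1 R))"
        using less.prems(2) by (simp add: h run_ok_append)
      show "vars E' \<inter> vars E = {}" if "E' \<in> set h2" for E'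
        using h2[OF that] by (auto simp: dependent_events_def)
    qed (use h less.prems(1) assms(1,5) in \<open>auto intro: run_table_space\<close>)
    then have ok: "run_ok ?h R" using less.prems(2) by (simp add: h run_ok_append)
    have evB1: "is_event n M B1" using B1(1) assms by auto
    have "head (run_table h R) v = head (run_table ?h R) v" if "v \<in> vars B1" for v
      unfolding tab using that EB evB1 by (intro head_advance) (auto simp: is_event_def)
    then have "head (run_table h R) \<in> outcomes B1 \<longleftrightarrow> head (run_table ?h R) \<in> outcomes B1"
      using assms(5) by (intro event_cong[OF evB1] head_space run_table_space)
    then have "head (run_table ?h R) \<in> outcomes B1" using B1(1) by simp
    moreover have "i \<in> vars B1" using B1(1) assms(4) by simp
    moreover from this have "run_table h R (i, k) = run_table ?h R (i, k)" for k
      using EB evB1 unfolding tab by (subst advance_apply) (auto simp: is_event_def)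
    ultimately show ?thesis
      using less.hyps[of ?h B1] less.prems ok B1(1) h by simp
  qed
qed

end

section \<open>Independence of the table entries\<close>

context resampling_table
begin

lemma prob_space_configs: "prob_space configs"
  by (rule prob_space_PiM) (rule prob_space_M)

lemma prob_space_tables: "prob_space tables"
  by (rule prob_space_PiM) (auto intro: prob_space_M)

lemma measurable_table_entry:
  "v \<in> {1..n} \<Longrightarrow> (\<lambda>R. R (v, k)) \<in> tables \<rightarrow>\<^sub>M M v"
  using measurable_component_singleton[of "(v, k)" "{1..n} \<times> UNIV" "\<lambda>p. M (fst p)"] by simp

lemma measurable_head [measurable]: "head \<in> tables \<rightarrow>\<^sub>M configs"
  unfolding head_def[abs_def]
  by (rule measurable_restrict) (rule measurable_table_entry)

lemma measurable_advance [measurable]: "advance V \<in> tables \<rightarrow>\<^sub>M tables"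
  unfolding advance_def[abs_def]
proof (rule measurable_restrict)
  fix p :: "nat \<times> nat" assume p: "p \<in> {1..n} \<times> UNIV"
  then have "(\<lambda>R. R (fst p, if fst p \<in> V then Suc (snd p) else snd p)) \<in> tables \<rightarrow>\<^sub>M M (fst p)"
    by (intro measurable_table_entry) (simp add: mem_Times_iff)
  then show "(\<lambda>R. case p of (v, k) \<Rightarrow> R (v, if v \<in> V then Suc k else k)) \<in> tables \<rightarrow>\<^sub>M M (fst p)"
    by (simp add: case_prod_beta)
qed

lemma measurable_seq_table [measurable]: "seq_table S \<in> tables \<rightarrow>\<^sub>M tables"
proof (induction S)
  case (Cons J S)
  have "seq_table (J # S) = advance (\<Union>(vars ` J)) \<circ> seq_table S" by auto
  then show ?case using Cons by (simp add: measurable_comp)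
qed simp

lemma measurable_run_table [measurable]: "run_table h \<in> tables \<rightarrow>\<^sub>M tables"
proof (induction h)
  case (Cons B h)
  have "run_table (B # h) = run_table h \<circ> advance (vars B)" by auto
  then show ?case using Cons by (simp add: measurable_comp[OF measurable_advance])
qed simp

text \<open>The set of columns may vary with the point of \<open>N\<close>, as the set
  \<open>resampled t w\<close> does.\<close>

lemma measurable_splice:
  assumes "\<And>v. v \<in> {1..n} \<Longrightarrow> Measurable.pred N (\<lambda>w. v \<in> V w)"
    and x: "x \<in> N \<rightarrow>\<^sub>M configs" and R: "R \<in> N \<rightarrow>\<^sub>M tables"
  shows "(\<lambda>w. splice (V w) (x w) (R w)) \<in> N \<rightarrow>\<^sub>M tables"
  unfolding splice_def
proof (rule measurable_restrict)
  fix p :: "nat \<times> nat" assume p: "p \<in> {1..n} \<times> UNIV"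
  obtain v k where vk: "p = (v, k)" by (cases p)
  then have v: "v \<in> {1..n}" using p by simp
  have entry: "(\<lambda>w. R w (v, j)) \<in> N \<rightarrow>\<^sub>M M v" for j
    by (rule measurable_compose[OF R measurable_table_entry[OF v]])
  have "(\<lambda>w. x w v) \<in> N \<rightarrow>\<^sub>M M v"
    by (rule measurable_compose[OF x measurable_component_singleton[OF v]])
  then have "(\<lambda>w. case k of 0 \<Rightarrow> x w v | Suc j \<Rightarrow> R w (v, j)) \<in> N \<rightarrow>\<^sub>M M v"
    using entry by (cases k) auto
  moreover have "{w \<in> space N. v \<in> V w} \<in> sets N" using assms(1)[OF v] by (simp add: pred_def)
  ultimately show "(\<lambda>w. case p of (v, k) \<Rightarrow>
      if v \<in> V w then (case k of 0 \<Rightarrow> x w v | Suc j \<Rightarrow> R w (v, j)) else R w (v, k))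
    \<in> N \<rightarrow>\<^sub>M M (fst p)"
    using entry by (simp add: vk)
qed

lemma measurable_splice_pair:
  "(\<lambda>(y, u). splice V y u) \<in> configs \<Otimes>\<^sub>M tables \<rightarrow>\<^sub>M tables"
  unfolding case_prod_beta by (rule measurable_splice) auto

section \<open>Fresh values pushed onto an independent table\<close>

lemma prod_emb_space_iff:
  assumes "f \<in> space (PiM I N)" "J \<subseteq> I"
  shows "f \<in> prod_emb I N J (Pi\<^sub>E J A) \<longleftrightarrow> (\<forall>j\<in>J. f j \<in> A j)"
  using assms by (auto simp: prod_emb_def space_PiM PiE_iff)

lemma vimage_pair_eq_Times:
  assumes "A \<subseteq> space N" "B \<subseteq> space N'"
    and "\<And>x y. x \<in> space N \<Longrightarrow> y \<in> space N' \<Longrightarrow> f x y \<in> E \<longleftrightarrow> x \<in> A \<and> y \<in> B"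
  shows "(\<lambda>(x, y). f x y) -` E \<inter> space (N \<Otimes>\<^sub>M N') = A \<times> B"
proof (rule set_eqI)
  fix p show "p \<in> (\<lambda>(x, y). f x y) -` E \<inter> space (N \<Otimes>\<^sub>M N') \<longleftrightarrow> p \<in> A \<times> B"
    using assms(1,2) assms(3)[of "fst p" "snd p"]
    by (cases p) (auto simp: space_pair_measure)
qed

text \<open>Pushing only renames positions, and the entries at distinct positions stay independent
  with the law of their column; it suffices to check this on cylinder sets.\<close>

lemma distr_splice: "distr (configs \<Otimes>\<^sub>M tables) tables (\<lambda>(y, u). splice V y u) = tables"
proof (rule measure_eqI_PiM_infinite)
  interpret C: prob_space configs by (rule prob_space_configs)
  interpret T: prob_space tables by (rule prob_space_tables)
  interpret CT: pair_prob_space configs tables ..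
  show "finite_measure (distr (configs \<Otimes>\<^sub>M tables) tables (\<lambda>(y, u). splice V y u))"
    by (rule prob_space.finite_measure, rule CT.prob_space_distr) (rule measurable_splice_pair)
  fix A :: "nat \<times> nat \<Rightarrow> 'a set" and J :: "(nat \<times> nat) set"
  assume J: "finite J" "J \<subseteq> {1..n} \<times> UNIV" and A: "\<And>p. p \<in> J \<Longrightarrow> A p \<in> sets (M (fst p))"
  \<comment> \<open>\<open>g\<close> sends a position of \<open>u\<close> to its position after the
    push. \<open>J1\<close> and \<open>J2\<close> collect the constraints of the cylinder that fall
    on \<open>y\<close> and on \<open>u\<close>.\<close>
  define g :: "nat \<times> nat \<Rightarrow> nat \<times> nat" where "g = (\<lambda>(v, k). (v, if v \<in> V then Suc k else k))"
  have g: "inj g" by (auto simp: inj_def g_def split: if_splits)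
  have fst_g: "fst (g p) = fst p" for p by (simp add: g_def split: prod.split)
  define J1 where "J1 = (\<lambda>v. (v, 0)) -` J \<inter> V"
  define J2 where "J2 = g -` J"
  have fin: "finite J1" "finite J2"
    unfolding J1_def J2_def using J(1) g by (auto intro!: finite_vimageI simp: inj_def)
  have sub: "J1 \<subseteq> {1..n}" "J2 \<subseteq> {1..n} \<times> UNIV"
    using J(2) by (auto simp: J1_def J2_def g_def)
  have split: "J = (\<lambda>v. (v, 0)) ` J1 \<union> g ` J2" "(\<lambda>v. (v, 0)) ` J1 \<inter> g ` J2 = {}"
  proof -
    have "p \<in> (\<lambda>v. (v, 0)) ` J1 \<union> g ` J2" if p: "p \<in> J" for p
    proof (cases "fst p \<in> V")
      case True
      show ?thesis
      proof (cases "snd p")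
        case 0
        then show ?thesis using p True by (cases p) (auto simp: J1_def)
      next
        case (Suc k)
        then have "p = g (fst p, k)" using True by (cases p) (simp add: g_def)
        then show ?thesis using p unfolding J2_def by auto
      qed
    next
      case False
      then have "p = g p" by (cases p) (simp add: g_def)
      then show ?thesis using p unfolding J2_def by auto
    qed
    then show "J = (\<lambda>v. (v, 0)) ` J1 \<union> g ` J2" by (auto simp: J1_def J2_def)
    show "(\<lambda>v. (v, 0)) ` J1 \<inter> g ` J2 = {}" by (auto simp: J1_def g_def)
  qed
  let ?E1 = "prod_emb {1..n} M J1 (\<Pi>\<^sub>E v\<in>J1. A (v, 0))"
  let ?E2 = "prod_emb ({1..n} \<times> UNIV) (\<lambda>p. M (fst p)) J2 (\<Pi>\<^sub>E p\<in>J2. A (g p))"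
  let ?E = "prod_emb ({1..n} \<times> UNIV) (\<lambda>p. M (fst p)) J (Pi\<^sub>E J A)"
  have A1: "A (v, 0) \<in> sets (M v)" if "v \<in> J1" for v
    using A[of "(v, 0)"] that by (simp add: J1_def)
  have A2: "A (g p) \<in> sets (M (fst p))" if "p \<in> J2" for p
    using A[of "g p"] that by (simp add: J2_def fst_g)
  have meas: "?E1 \<in> sets configs" "?E2 \<in> sets tables" "?E \<in> sets tables"
    using J A A1 A2 fin sub by (auto intro!: sets_PiM_I)
  have "(\<lambda>(y, u). splice V y u) -` ?E \<inter> space (configs \<Otimes>\<^sub>M tables) = ?E1 \<times> ?E2"
  proof (rule vimage_pair_eq_Times)
    show "?E1 \<subseteq> space configs" "?E2 \<subseteq> space tables"
      using meas(1,2) by (auto dest: sets.sets_into_space)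
    show "splice V y u \<in> ?E \<longleftrightarrow> y \<in> ?E1 \<and> u \<in> ?E2"
      if yu: "y \<in> space configs" "u \<in> space tables" for y u
    proof -
      have s0: "splice V y u (v, 0) = y v" if "v \<in> J1" for v
        using that sub by (subst splice_apply) (auto simp: J1_def)
      have s2: "splice V y u (g p) = u p" if "p \<in> J2" for p
        using that sub by (cases p) (auto simp: g_def splice_apply)
      have "splice V y u \<in> ?E \<longleftrightarrow> (\<forall>p\<in>J. splice V y u p \<in> A p)"
        using yu J(2) by (intro prod_emb_space_iff splice_space)
      also have "\<dots> \<longleftrightarrow> (\<forall>v\<in>J1. y v \<in> A (v, 0)) \<and> (\<forall>p\<in>J2. u p \<in> A (g p))"
        by (subst split(1)) (simp add: ball_Un s0 s2)
      also have "(\<forall>v\<in>J1. y v \<in> A (v, 0)) \<longleftrightarrow> y \<in> ?E1"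
        using yu(1) sub(1) by (rule prod_emb_space_iff[symmetric])
      also have "(\<forall>p\<in>J2. u p \<in> A (g p)) \<longleftrightarrow> u \<in> ?E2"
        using yu(2) sub(2) by (rule prod_emb_space_iff[symmetric])
      finally show ?thesis .
    qed
  qed
  then have "emeasure (distr (configs \<Otimes>\<^sub>M tables) tables (\<lambda>(y, u). splice V y u)) ?E
      = emeasure (configs \<Otimes>\<^sub>M tables) (?E1 \<times> ?E2)"
    by (simp only: emeasure_distr[OF measurable_splice_pair meas(3)])
  also have "\<dots> = emeasure configs ?E1 * emeasure tables ?E2"
    using meas by (intro T.emeasure_pair_measure_Times)
  also have "emeasure configs ?E1 = (\<Prod>v\<in>J1. emeasure (M v) (A (v, 0)))"
    using fin sub A1 prob_space_M by (intro emeasure_PiM_emb) auto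
  also have "emeasure tables ?E2 = (\<Prod>p\<in>J2. emeasure (M (fst p)) (A (g p)))"
    using fin sub A2 prob_space_M by (intro emeasure_PiM_emb) auto
  also have "(\<Prod>v\<in>J1. emeasure (M v) (A (v, 0)))
      = (\<Prod>p\<in>(\<lambda>v. (v, 0)) ` J1. emeasure (M (fst p)) (A p))"
    by (subst prod.reindex) (auto simp: inj_on_def)
  also have "(\<Prod>p\<in>J2. emeasure (M (fst p)) (A (g p))) = (\<Prod>p\<in>g ` J2. emeasure (M (fst p)) (A p))"
    using g by (subst prod.reindex) (auto simp: fst_g intro: inj_on_subset)
  also have "(\<Prod>p\<in>(\<lambda>v. (v, 0)) ` J1. emeasure (M (fst p)) (A p)) * \<dots>
      = (\<Prod>p\<in>J. emeasure (M (fst p)) (A p))"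
    unfolding split(1)
    by (rule prod.union_disjoint[symmetric]) (use fin split(2) in auto)
  also have "\<dots> = emeasure tables ?E"
    using J A prob_space_M by (intro emeasure_PiM_emb[symmetric]) auto
  finally show "emeasure (distr (configs \<Otimes>\<^sub>M tables) tables (\<lambda>(y, u). splice V y u)) ?E
    = emeasure tables ?E" .
qed simp_all

text \<open>By \<open>distr_splice\<close> a table may be taken to be \<open>splice V y u\<close>.
  Its head agrees with \<open>y\<close> on \<open>V\<close>, and advancing \<open>V\<close> gives
  back \<open>u\<close>, so the event becomes the rectangle \<open>Z \<times> G\<close>.\<close>

lemma measure_head_advance:
  assumes "Z \<in> sets configs" "G \<in> sets tables" "V \<subseteq> {1..n}"
    and Z: "\<And>x y. x \<in> space configs \<Longrightarrow> y \<in> space configs \<Longrightarrow> (\<And>v. v \<in> V \<Longrightarrow> x v = y v)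
      \<Longrightarrow> x \<in> Z \<longleftrightarrow> y \<in> Z"
  shows "measure tables {R \<in> space tables. head R \<in> Z \<and> advance V R \<in> G}
    = measure configs Z * measure tables G"
proof -
  interpret T: prob_space tables by (rule prob_space_tables)
  let ?E = "{R \<in> space tables. head R \<in> Z \<and> advance V R \<in> G}"
  have E: "?E \<in> sets tables" using assms(1,2) by measurable
  have "(\<lambda>(y, u). splice V y u) -` ?E \<inter> space (configs \<Otimes>\<^sub>M tables) = Z \<times> G"
  proof (rule vimage_pair_eq_Times)
    show "Z \<subseteq> space configs" "G \<subseteq> space tables"
      using assms(1,2) by (auto dest: sets.sets_into_space)
    show "splice V y u \<in> ?E \<longleftrightarrow> y \<in> Z \<and> u \<in> G" if yu: "y \<in> space configs" "u \<in> space tables" for y u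
    proof -
      have "head (splice V y u) v = y v" if "v \<in> V" for v
        using that assms(3) by (subst head_apply) (auto simp: splice_apply)
      then have "head (splice V y u) \<in> Z \<longleftrightarrow> y \<in> Z"
        using yu by (intro Z head_space splice_space)
      then show ?thesis using yu by (simp add: splice_space advance_splice)
    qed
  qed
  then have "emeasure tables ?E = emeasure (configs \<Otimes>\<^sub>M tables) (Z \<times> G)"
    using emeasure_distr[OF measurable_splice_pair E, of V] by (simp only: distr_splice)
  also have "\<dots> = emeasure configs Z * emeasure tables G"
    using assms by (intro T.emeasure_pair_measure_Times)
  finally show ?thesis by (simp add: measure_def enn2real_mult)
qed

lemma measure_head:
  assumes "Z \<in> sets configs"
  shows "measure tables {R \<in> space tables. head R \<in> Z} = measure configs Z"
proof -
  interpret T: prob_space tables by (rule prob_space_tables)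
  have "measure tables {R \<in> space tables. head R \<in> Z \<and> advance {1..n} R \<in> space tables}
    = measure configs Z * measure tables (space tables)"
  proof (rule measure_head_advance[OF assms sets.top])
    fix x y assume "x \<in> space configs" "y \<in> space configs" "\<And>v. v \<in> {1..n} \<Longrightarrow> x v = y v"
    then have "x = y" by (intro config_eqI) (auto simp: space_extensional)
    then show "x \<in> Z \<longleftrightarrow> y \<in> Z" by simp
  qed simp
  moreover have "{R \<in> space tables. head R \<in> Z \<and> advance {1..n} R \<in> space tables}
    = {R \<in> space tables. head R \<in> Z}" by (auto intro: advance_space)
  ultimately show ?thesis by (simp add: T.prob_space)
qed

lemma measure_advance:
  assumes "G \<in> sets tables"
  shows "measure tables {R \<in> space tables. advance V R \<in> G} = measure tables G"
proof -
  interpret C: prob_space configs by (rule prob_space_configs)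
  have "advance V R = advance (V \<inter> {1..n}) R" for R
    by (rule table_eqI) (simp_all add: extensional_table advance_apply)
  moreover have "measure tables {R \<in> space tables. head R \<in> space configs \<and> advance (V \<inter> {1..n}) R \<in> G}
    = measure configs (space configs) * measure tables G"
    by (rule measure_head_advance) (use assms in auto)
  moreover have "{R \<in> space tables. head R \<in> space configs \<and> advance V R \<in> G}
    = {R \<in> space tables. advance V R \<in> G}" by (auto intro: head_space)
  ultimately show ?thesis by (simp add: C.prob_space)
qed

text \<open>The list \<open>h\<close> is fixed in advance and nothing is asked about the truth of
  its events. Hence a null set of states stays null after any fixed history.\<close>

lemma measure_run_table:
  assumes "G \<in> sets tables"
  shows "measure tables {R \<in> space tables. run_table h R \<in> G} = measure tables G"
proof (induction h)
  case Nil
  have "{R \<in> space tables. R \<in> G} = G" using assms sets.sets_into_space by auto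
  then show ?case by simp
next
  case (Cons B h)
  have "{R \<in> space tables. run_table (B # h) R \<in> G}
    = {R \<in> space tables. advance (vars B) R \<in> {R \<in> space tables. run_table h R \<in> G}}"
    by (auto intro: advance_space)
  moreover have "{R \<in> space tables. run_table h R \<in> G} \<in> sets tables"
    using assms by measurable
  ultimately show ?case using Cons by (simp only: measure_advance)
qed

text \<open>Independence read off a table: \<open>Z\<close> does not notice that the columns of
  \<open>B\<close> are advanced, so it can be tested on the advanced table, which is independent of
  the head on \<open>vars B\<close>.\<close>

lemma measure_Int_indep:
  assumes "is_event n M B" "Z \<in> sets configs" "V \<inter> vars B = {}"
    and Z: "\<And>x y. x \<in> space configs \<Longrightarrow> y \<in> space configs \<Longrightarrow> (\<And>v. v \<in> V \<Longrightarrow> x v = y v)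
      \<Longrightarrow> x \<in> Z \<longleftrightarrow> y \<in> Z"
  shows "measure configs (outcomes B \<inter> Z) = pr configs B * measure configs Z"
proof -
  have B: "outcomes B \<in> sets configs" "vars B \<subseteq> {1..n}"
    using assms(1) by (auto simp: is_event_def)
  have "measure configs (outcomes B \<inter> Z)
    = measure tables {R \<in> space tables. head R \<in> outcomes B \<inter> Z}"
    using B(1) assms(2) by (intro measure_head[symmetric]) auto
  also have "{R \<in> space tables. head R \<in> outcomes B \<inter> Z} = {R \<in> space tables. head R \<in> outcomes B
      \<and> advance (vars B) R \<in> {R \<in> space tables. head R \<in> Z}}"
  proof -
    have "head (advance (vars B) R) \<in> Z \<longleftrightarrow> head R \<in> Z" if R: "R \<in> space tables" for R
    proof (rule Z)
      fix v assume "v \<in> V"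
      then have "v \<notin> vars B" using assms(3) by auto
      then show "head (advance (vars B) R) v = head R v"
        by (simp add: head_def advance_apply)
    qed (use R in \<open>auto intro: head_space advance_space\<close>)
    then show ?thesis by (auto intro: advance_space)
  qed
  also have "measure tables \<dots> = measure configs (outcomes B) * measure tables {R \<in> space tables. head R \<in> Z}"
  proof (rule measure_head_advance[OF B(1) _ B(2)])
    show "{R \<in> space tables. head R \<in> Z} \<in> sets tables" using assms(2) by measurable
  qed (rule event_cong[OF assms(1)])
  finally show ?thesis by (simp add: measure_head[OF assms(2)] pr_def)
qed

lemma sets_all_outcomes:
  assumes "finite J" "\<And>B. B \<in> J \<Longrightarrow> is_event n M B"
  shows "{x \<in> space configs. \<forall>B\<in>J. x \<in> outcomes B} \<in> sets configs"
proof (rule sets.sets_Collect_finite_All)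
  fix B assume "B \<in> J"
  then have "outcomes B \<in> sets configs" using assms(2) by (simp add: is_event_def)
  then show "{x \<in> space configs. x \<in> outcomes B} \<in> sets configs" by measurable
qed (rule assms(1))

lemma measure_stable_Inter:
  assumes "finite J" "stable J" "\<And>B. B \<in> J \<Longrightarrow> is_event n M B"
  shows "measure configs {x \<in> space configs. \<forall>B\<in>J. x \<in> outcomes B} = (\<Prod>B\<in>J. pr configs B)"
  using assms
proof (induction J)
  case empty
  interpret C: prob_space configs by (rule prob_space_configs)
  show ?case by (simp add: C.prob_space)
next
  case (insert B J)
  let ?Z = "{x \<in> space configs. \<forall>B\<in>J. x \<in> outcomes B}"
  have meas: "outcomes E \<in> sets configs" if "E \<in> insert B J" for E
    using insert.prems(2) that by (simp add: is_event_def)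
  have "measure configs (outcomes B \<inter> ?Z) = pr configs B * measure configs ?Z"
  proof (rule measure_Int_indep)
    show "?Z \<in> sets configs"
      using insert.hyps(1) insert.prems(2) by (intro sets_all_outcomes) auto
    show "\<Union>(vars ` J) \<inter> vars B = {}"
      using insert.prems(1) insert.hyps(2)
      by (fastforce simp: stable_def pairwise_def dependent_events_def)
    fix x y assume xy: "x \<in> space configs" "y \<in> space configs" "\<And>v. v \<in> \<Union>(vars ` J) \<Longrightarrow> x v = y v"
    have "x \<in> outcomes E \<longleftrightarrow> y \<in> outcomes E" if "E \<in> J" for E
      using that xy insert.prems(2) by (intro event_cong[of n M E]) auto
    then show "x \<in> ?Z \<longleftrightarrow> y \<in> ?Z" using xy by auto
  qed (use insert.prems in auto)
  moreover have "outcomes B \<inter> ?Z = {x \<in> space configs. \<forall>B\<in>insert B J. x \<in> outcomes B}"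
    using sets.sets_into_space[OF meas[of B]] by auto
  moreover have "measure configs ?Z = (\<Prod>B\<in>J. pr configs B)"
    using insert.prems by (intro insert.IH) (auto intro: stable_subset)
  ultimately show ?case using insert.hyps by simp
qed

lemma measurable_seq_ok:
  assumes "stable_seq C S" "finite C" "\<And>B. B \<in> C \<Longrightarrow> is_event n M B"
  shows "{R \<in> space tables. seq_ok S R} \<in> sets tables"
  using assms(1)
proof (induction S)
  case (Cons J S)
  have J: "J \<subseteq> C" "finite J" using Cons.prems assms(2) finite_subset[of J C] by auto
  have "{R \<in> space tables. head (seq_table S R) \<in> outcomes B} \<in> sets tables" if "B \<in> J" for B
  proof -
    have "outcomes B \<in> sets configs" using that J assms(3) by (auto simp: is_event_def)
    then show ?thesis by measurable
  qed
  then have "{R \<in> space tables. \<forall>B\<in>J. head (seq_table S R) \<in> outcomes B} \<in> sets tables"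
    using J by (intro sets.sets_Collect_finite_All)
  moreover have "{R \<in> space tables. seq_ok S R} \<in> sets tables"
    using Cons by simp
  ultimately show ?case by (simp add: sets.sets_Collect_conj)
qed simp

text \<open>After a fixed sequence has been checked, the rest of the table is again a table of
  independent values, independent of the check. \<open>G\<close> is arbitrary so that the induction
  can move the test of the top level into it.\<close>

lemma measure_seq_ok:
  assumes "stable_seq C S" "finite C" "\<And>B. B \<in> C \<Longrightarrow> is_event n M B" "G \<in> sets tables"
  shows "measure tables {R \<in> space tables. seq_ok S R \<and> seq_table S R \<in> G}
    = seq_weight configs S * measure tables G"
  using assms(1,4)
proof (induction S arbitrary: G)
  case Nil
  then have "{R \<in> space tables. R \<in> G} = G" using sets.sets_into_space by auto
  then show ?case by (simp add: seq_weight_def)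
next
  case (Cons J S)
  have J: "J \<subseteq> C" "finite J" "stable J" using Cons.prems assms(2) finite_subset[of J C] by auto
  let ?Z = "{x \<in> space configs. \<forall>B\<in>J. x \<in> outcomes B}"
  let ?G = "{R \<in> space tables. head R \<in> ?Z \<and> advance (\<Union>(vars ` J)) R \<in> G}"
  have Z: "?Z \<in> sets configs"
    using J assms(3) by (intro sets_all_outcomes) auto
  have "{R \<in> space tables. seq_ok (J # S) R \<and> seq_table (J # S) R \<in> G}
    = {R \<in> space tables. seq_ok S R \<and> seq_table S R \<in> ?G}"
    by (auto intro: seq_table_space head_space)
  moreover have "measure tables {R \<in> space tables. seq_ok S R \<and> seq_table S R \<in> ?G}
    = seq_weight configs S * measure tables ?G"
  proof (rule Cons.IH)
    show "?G \<in> sets tables" using Z Cons.prems(2) by measurable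
  qed (use Cons.prems in auto)
  moreover have "measure tables ?G = measure configs ?Z * measure tables G"
  proof (rule measure_head_advance[OF Z Cons.prems(2)])
    show "\<Union>(vars ` J) \<subseteq> {1..n}" using J assms(3) by (fastforce simp: is_event_def)
    fix x y assume xy: "x \<in> space configs" "y \<in> space configs" "\<And>v. v \<in> \<Union>(vars ` J) \<Longrightarrow> x v = y v"
    have "x \<in> outcomes E \<longleftrightarrow> y \<in> outcomes E" if "E \<in> J" for E
      using that xy J assms(3) by (intro event_cong[of n M E]) auto
    then show "x \<in> ?Z \<longleftrightarrow> y \<in> ?Z" using xy by auto
  qed
  moreover have "measure configs ?Z = (\<Prod>B\<in>J. pr configs B)"
    using J assms(3) by (intro measure_stable_Inter) auto
  ultimately show ?case by (simp add: seq_weight_def)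
qed

end

section \<open>Coupling a run with a table\<close>

context resampling_table
begin

lemma nn_integral_splice:
  assumes [measurable]: "f \<in> borel_measurable tables"
  shows "(\<integral>\<^sup>+y. \<integral>\<^sup>+u. f (splice V y u) \<partial>tables \<partial>configs) = (\<integral>\<^sup>+R. f R \<partial>tables)"
proof -
  interpret T: prob_space tables by (rule prob_space_tables)
  note [measurable] = measurable_splice_pair
  have "(\<integral>\<^sup>+R. f R \<partial>tables)
    = (\<integral>\<^sup>+R. f R \<partial>distr (configs \<Otimes>\<^sub>M tables) tables (\<lambda>(y, u). splice V y u))"
    by (simp only: distr_splice)
  also have "\<dots> = (\<integral>\<^sup>+p. f ((\<lambda>(y, u). splice V y u) p) \<partial>(configs \<Otimes>\<^sub>M tables))"
    by (rule nn_integral_distr) measurable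
  also have "\<dots> = (\<integral>\<^sup>+y. \<integral>\<^sup>+u. f ((\<lambda>(y, u). splice V y u) (y, u)) \<partial>tables \<partial>configs)"
    by (rule T.nn_integral_fst[symmetric]) measurable
  finally show ?thesis by simp
qed

text \<open>Exchanging the order of two splices turns a resampling step of the run into a resampling of the
  unread part of the table.\<close>

lemma splice_splice:
  "splice V x (splice {1..n} (override_on x y V) u) = splice {1..n} x (splice V y u)"
  by (rule table_eqI)
    (auto simp: extensional_table splice_apply override_on_def split: nat.split)

lemma head_splice: "x \<in> space configs \<Longrightarrow> head (splice {1..n} x u) = x"
  by (rule config_eqI)
    (auto simp: extensional_table space_extensional head_apply splice_apply)

lemma head_splice_override:
  assumes "x \<in> space configs" "head R = override_on x y V"
  shows "head (splice V x R) = x"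
proof (rule config_eqI)
  fix v assume v: "v \<in> {1..n}"
  have "R (v, 0) = override_on x y V v" using assms(2) head_apply[OF v, of R] by simp
  then show "head (splice V x R) v = x v"
    using v by (simp add: head_apply splice_apply override_on_def)
qed (use assms(1) in \<open>auto simp: extensional_table space_extensional\<close>)

end

section \<open>Rebuilding the table behind a run\<close>

locale resampling_run =
  moser_tardos_run P F n M Bs X sel Y + resampling_table n M
  for P :: "'w measure" and F :: "nat \<Rightarrow> 'w measure" and n :: nat and M :: "nat \<Rightarrow> 'a measure"
    and Bs :: "'a event set" and X :: "nat \<Rightarrow> 'w \<Rightarrow> nat \<Rightarrow> 'a"
    and sel :: "nat \<Rightarrow> 'w \<Rightarrow> 'a event" and Y :: "nat \<Rightarrow> 'w \<Rightarrow> nat \<Rightarrow> 'a" +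
  assumes finite_Bs: "finite Bs"
    and is_event_Bs: "B \<in> Bs \<Longrightarrow> is_event n M B"
begin

text \<open>Empty once the run has stopped, so that \<open>X_Suc\<close> needs no case distinction
  and idle steps discard no value.\<close>

definition resampled :: "nat \<Rightarrow> 'w \<Rightarrow> nat set" where
  "resampled t w = (if no_bad_event Bs (X t w) then {} else vars (sel t w))"

text \<open>
  \<open>past t w\<close> prepends to a table of the values that are read from time \<open>t\<close> on the values
  that were discarded before time \<open>t\<close>.
\<close>

fun past :: "nat \<Rightarrow> 'w \<Rightarrow> (nat \<times> nat \<Rightarrow> 'a) \<Rightarrow> nat \<times> nat \<Rightarrow> 'a" where
  "past 0 w R = R"
| "past (Suc t) w R = past t w (splice (resampled t w) (X t w) R)"

definition run_history :: "nat \<Rightarrow> 'w \<Rightarrow> (nat \<times> nat \<Rightarrow> 'a) \<Rightarrow> nat \<times> nat \<Rightarrow> 'a" where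
  "run_history t w u = past t w (splice {1..n} (X t w) u)"

lemma X_Suc: "w \<in> space P \<Longrightarrow> X (Suc t) w = override_on (X t w) (Y t w) (resampled t w)"
  by (simp add: X_step resampled_def)

lemma X_space: "w \<in> space P \<Longrightarrow> X t w \<in> space configs"
  using measurable_space[OF X_adapted] by (simp add: space_F)

lemma subalgebra_F_mono: "t \<le> s \<Longrightarrow> subalgebra (F s) (F t)"
  using sets_F_mono by (simp add: subalgebra_def space_F)

lemma X_measurable: "t \<le> s \<Longrightarrow> X t \<in> F s \<rightarrow>\<^sub>M configs"
  by (rule measurable_from_subalg[OF subalgebra_F_mono X_adapted])

lemma sel_measurable: "t \<le> s \<Longrightarrow> sel t \<in> F s \<rightarrow>\<^sub>M count_space UNIV"
  by (rule measurable_from_subalg[OF subalgebra_F_mono sel_adapted])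

lemma sets_no_bad_event: "{x \<in> space configs. no_bad_event Bs x} \<in> sets configs"
  unfolding no_bad_event_def
proof (rule sets.sets_Collect_finite_All)
  fix B assume "B \<in> Bs"
  then have "outcomes B \<in> sets configs" using is_event_Bs by (simp add: is_event_def)
  then show "{x \<in> space configs. x \<notin> outcomes B} \<in> sets configs" by measurable
qed (rule finite_Bs)

lemma resampled_measurable:
  assumes "t \<le> s"
  shows "Measurable.pred (F s) (\<lambda>w. v \<in> resampled t w)"
proof -
  have "{w \<in> space (F s). no_bad_event Bs (X t w)} = X t -` {x \<in> space configs. no_bad_event Bs x} \<inter> space (F s)"
    using X_space by (auto simp: space_F)
  then have [measurable]: "Measurable.pred (F s) (\<lambda>w. no_bad_event Bs (X t w))"
    using measurable_sets[OF X_measurable[OF assms] sets_no_bad_event] by (simp add: pred_def)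
  have "{w \<in> space (F s). v \<in> vars (sel t w)} = sel t -` {B. v \<in> vars B} \<inter> space (F s)" by auto
  then have [measurable]: "Measurable.pred (F s) (\<lambda>w. v \<in> vars (sel t w))"
    using measurable_sets[OF sel_measurable[OF assms], of "{B. v \<in> vars B}"] by (simp add: pred_def)
  have "v \<in> resampled t w \<longleftrightarrow> \<not> no_bad_event Bs (X t w) \<and> v \<in> vars (sel t w)" for w
    by (simp add: resampled_def)
  then show ?thesis by simp
qed

lemma past_measurable:
  "t \<le> s \<Longrightarrow> (\<lambda>p. past t (fst p) (snd p)) \<in> F s \<Otimes>\<^sub>M tables \<rightarrow>\<^sub>M tables"
proof (induction t)
  case (Suc t)
  have "(\<lambda>p. splice (resampled t (fst p)) (X t (fst p)) (snd p)) \<in> F s \<Otimes>\<^sub>M tables \<rightarrow>\<^sub>M tables"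
  proof (rule measurable_splice)
    show "Measurable.pred (F s \<Otimes>\<^sub>M tables) (\<lambda>p. v \<in> resampled t (fst p))" for v
      using Suc.prems by (intro measurable_compose[OF measurable_fst resampled_measurable]) simp
    show "(\<lambda>p. X t (fst p)) \<in> F s \<Otimes>\<^sub>M tables \<rightarrow>\<^sub>M configs"
      using Suc.prems by (intro measurable_compose[OF measurable_fst X_measurable]) simp
  qed (rule measurable_snd)
  then have "(\<lambda>p. (fst p, splice (resampled t (fst p)) (X t (fst p)) (snd p)))
    \<in> F s \<Otimes>\<^sub>M tables \<rightarrow>\<^sub>M F s \<Otimes>\<^sub>M tables" by (intro measurable_Pair measurable_fst)
  from measurable_compose[OF this Suc.IH] Suc.prems
  show ?case by simp
qed simp

text \<open>Turns independence of set systems into a product law, with \<open>P\<close> restricted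
  to \<open>F t\<close>, so that Fubini can integrate out \<open>Y t\<close> while the history is
  held fixed.\<close>

lemma Y_joint_distr:
  "distr P (F t \<Otimes>\<^sub>M configs) (\<lambda>w. (w, Y t w)) = distr P (F t) (\<lambda>w. w) \<Otimes>\<^sub>M configs"
proof -
  have id: "(\<lambda>w. w) \<in> P \<rightarrow>\<^sub>M F t"
    by (rule measurable_from_subalg[OF subalgebra_F[of t]]) simp
  have wY: "(\<lambda>w. (w, Y t w)) \<in> P \<rightarrow>\<^sub>M F t \<Otimes>\<^sub>M configs"
    using id Y_measurable by (rule measurable_Pair)
  interpret C: prob_space configs by (rule prob_space_configs)
  interpret Ft: prob_space "distr P (F t) (\<lambda>w. w)" using id by (rule prob_space_distr)
  show ?thesis
  proof (rule pair_measure_eqI[symmetric])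
    fix A B assume AB: "A \<in> sets (distr P (F t) (\<lambda>w. w))" "B \<in> sets configs"
    have A: "A \<in> sets (F t)" "A \<inter> space P = A"
      using AB(1) sets.sets_into_space[of A "F t"] by (auto simp: space_F)
    have Y: "Y t -` B \<inter> space P \<in> sets (vimage_algebra (space P) (Y t) configs)"
      using AB(2) by (rule in_vimage_algebra)
    have "emeasure (distr P (F t) (\<lambda>w. w)) A = emeasure P A"
      using emeasure_distr[OF id A(1)] A(2) by simp
    moreover have "emeasure configs B = emeasure P (Y t -` B \<inter> space P)"
      using emeasure_distr[OF Y_measurable AB(2)] by (simp only: Y_distr)
    moreover have "emeasure (distr P (F t \<Otimes>\<^sub>M configs) (\<lambda>w. (w, Y t w))) (A \<times> B)
      = emeasure P (A \<inter> (Y t -` B \<inter> space P))"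
    proof -
      have "(\<lambda>w. (w, Y t w)) -` (A \<times> B) \<inter> space P = A \<inter> (Y t -` B \<inter> space P)"
        by auto
      then show ?thesis using emeasure_distr[OF wY, of "A \<times> B"] A(1) AB(2) by simp
    qed
    moreover have "prob (A \<inter> (Y t -` B \<inter> space P)) = prob A * prob (Y t -` B \<inter> space P)"
      by (rule indep_setD[OF Y_indep A(1) Y])
    ultimately show "emeasure (distr P (F t) (\<lambda>w. w)) A * emeasure configs B
      = emeasure (distr P (F t \<Otimes>\<^sub>M configs) (\<lambda>w. (w, Y t w))) (A \<times> B)"
      by (simp add: emeasure_eq_measure ennreal_mult)
  qed (simp_all add: Ft.sigma_finite_measure_axioms C.sigma_finite_measure_axioms
      cong: sets_pair_measure_cong)
qed

text \<open>
  Filling up the values that are read by the run until time \<open>t\<close> with an independent table yields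
  a table of independent values.
\<close>

lemma nn_integral_run_history:
  assumes [measurable]: "f \<in> borel_measurable tables"
  shows "(\<integral>\<^sup>+w. \<integral>\<^sup>+u. f (run_history t w u) \<partial>tables \<partial>P) = (\<integral>\<^sup>+R. f R \<partial>tables)"
proof (induction t)
  case 0
  interpret T: prob_space tables by (rule prob_space_tables)
  let ?g = "\<lambda>y. \<integral>\<^sup>+u. f (splice {1..n} y u) \<partial>tables"
  have "(\<lambda>p. f ((\<lambda>(y, u). splice {1..n} y u) p)) \<in> borel_measurable (configs \<Otimes>\<^sub>M tables)"
    by (rule measurable_compose[OF measurable_splice_pair assms])
  then have g: "?g \<in> borel_measurable configs"
    using T.borel_measurable_nn_integral_fst[of "\<lambda>p. f ((\<lambda>(y, u). splice {1..n} y u) p)" configs]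
    by simp
  have X0: "X 0 \<in> P \<rightarrow>\<^sub>M configs"
    by (rule measurable_from_subalg[OF subalgebra_F X_adapted])
  have "(\<integral>\<^sup>+w. \<integral>\<^sup>+u. f (run_history 0 w u) \<partial>tables \<partial>P) = (\<integral>\<^sup>+w. ?g (X 0 w) \<partial>P)"
    by (simp add: run_history_def)
  also have "\<dots> = (\<integral>\<^sup>+y. ?g y \<partial>distr P configs (X 0))"
    using g by (intro nn_integral_distr[OF X0, symmetric]) simp
  also have "\<dots> = (\<integral>\<^sup>+y. ?g y \<partial>configs)"
    by (simp only: X_initial)
  finally show ?case by (simp add: nn_integral_splice)
next
  case (Suc t)
  interpret T: prob_space tables by (rule prob_space_tables)
  interpret C: prob_space configs by (rule prob_space_configs)
  \<comment> \<open>\<open>?h w R\<close> puts \<open>R\<close> below the state at time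
    \<open>t\<close>. By \<open>splice_splice\<close>, the next state on top of \<open>u\<close>
    amounts to the old state on top of \<open>u\<close> with \<open>Y t\<close> pushed onto the
    resampled columns. Averaging over \<open>Y t\<close> and \<open>u\<close> turns that lower table
    into a fresh one, which is the situation at time \<open>t\<close>.\<close>
  let ?h = "\<lambda>w R. f (past t w (splice {1..n} (X t w) R))"
  let ?g = "\<lambda>w y. \<integral>\<^sup>+u. ?h w (splice (resampled t w) y u) \<partial>tables"
  have past: "(\<lambda>p. ?h (fst p) (snd p)) \<in> borel_measurable (F t \<Otimes>\<^sub>M tables)"
  proof -
    have "(\<lambda>p. splice {1..n} (X t (fst p)) (snd p)) \<in> F t \<Otimes>\<^sub>M tables \<rightarrow>\<^sub>M tables"
      by (rule measurable_splice)
        (auto intro: measurable_compose[OF measurable_fst X_measurable])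
    then have "(\<lambda>p. (fst p, splice {1..n} (X t (fst p)) (snd p)))
      \<in> F t \<Otimes>\<^sub>M tables \<rightarrow>\<^sub>M F t \<Otimes>\<^sub>M tables" by (intro measurable_Pair measurable_fst)
    from measurable_compose[OF measurable_compose[OF this past_measurable] assms]
    show ?thesis by simp
  qed
  have "(\<lambda>p. ?h (fst (fst p)) (splice (resampled t (fst (fst p))) (snd (fst p)) (snd p)))
    \<in> borel_measurable ((F t \<Otimes>\<^sub>M configs) \<Otimes>\<^sub>M tables)"
  proof -
    have fst_fst: "(\<lambda>p. fst (fst p)) \<in> (F t \<Otimes>\<^sub>M configs) \<Otimes>\<^sub>M tables \<rightarrow>\<^sub>M F t"
      by (rule measurable_compose[OF measurable_fst measurable_fst])
    have "(\<lambda>p. splice (resampled t (fst (fst p))) (snd (fst p)) (snd p))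
      \<in> (F t \<Otimes>\<^sub>M configs) \<Otimes>\<^sub>M tables \<rightarrow>\<^sub>M tables"
    proof (rule measurable_splice)
      show "Measurable.pred ((F t \<Otimes>\<^sub>M configs) \<Otimes>\<^sub>M tables) (\<lambda>p. v \<in> resampled t (fst (fst p)))" for v
        by (rule measurable_compose[OF fst_fst resampled_measurable]) simp
    qed (rule measurable_compose[OF measurable_fst measurable_snd], rule measurable_snd)
    then have "(\<lambda>p. (fst (fst p), splice (resampled t (fst (fst p))) (snd (fst p)) (snd p)))
      \<in> (F t \<Otimes>\<^sub>M configs) \<Otimes>\<^sub>M tables \<rightarrow>\<^sub>M F t \<Otimes>\<^sub>M tables"
      using fst_fst by (intro measurable_Pair)
    from measurable_compose[OF this past] show ?thesis by simp
  qed
  then have g: "(\<lambda>p. ?g (fst p) (snd p)) \<in> borel_measurable (F t \<Otimes>\<^sub>M configs)"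
    by (rule T.borel_measurable_nn_integral_fst[of "\<lambda>p. ?h (fst (fst p)) (splice (resampled t (fst (fst p))) (snd (fst p)) (snd p))", simplified])
  have id: "(\<lambda>w. w) \<in> P \<rightarrow>\<^sub>M F t"
    by (rule measurable_from_subalg[OF subalgebra_F[of t]]) simp
  have wY: "(\<lambda>w. (w, Y t w)) \<in> P \<rightarrow>\<^sub>M F t \<Otimes>\<^sub>M configs"
    using id Y_measurable by (rule measurable_Pair)
  have "(\<integral>\<^sup>+w. \<integral>\<^sup>+u. f (run_history (Suc t) w u) \<partial>tables \<partial>P) = (\<integral>\<^sup>+w. ?g w (Y t w) \<partial>P)"
    by (rule nn_integral_cong) (simp add: run_history_def X_Suc splice_splice)
  also have "\<dots> = (\<integral>\<^sup>+p. ?g (fst p) (snd p) \<partial>distr P (F t \<Otimes>\<^sub>M configs) (\<lambda>w. (w, Y t w)))"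
    using g by (subst nn_integral_distr[OF wY]) simp_all
  also have "\<dots> = (\<integral>\<^sup>+p. ?g (fst p) (snd p) \<partial>(distr P (F t) (\<lambda>w. w) \<Otimes>\<^sub>M configs))"
    by (simp only: Y_joint_distr)
  also have "\<dots> = (\<integral>\<^sup>+w. \<integral>\<^sup>+y. ?g w y \<partial>configs \<partial>distr P (F t) (\<lambda>w. w))"
  proof (subst C.nn_integral_fst[symmetric])
    show "(\<lambda>p. ?g (fst p) (snd p)) \<in> borel_measurable (distr P (F t) (\<lambda>w. w) \<Otimes>\<^sub>M configs)"
      using g by (simp cong: measurable_cong_sets sets_pair_measure_cong)
  qed simp
  also have "\<dots> = (\<integral>\<^sup>+w. \<integral>\<^sup>+R. ?h w R \<partial>tables \<partial>distr P (F t) (\<lambda>w. w))"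
  proof (rule nn_integral_cong)
    fix w assume "w \<in> space (distr P (F t) (\<lambda>w. w))"
    then have "w \<in> space (F t)" by simp
    then have "(\<lambda>R. (w, R)) \<in> tables \<rightarrow>\<^sub>M F t \<Otimes>\<^sub>M tables" by (rule measurable_Pair1')
    from measurable_compose[OF this past]
    show "(\<integral>\<^sup>+y. ?g w y \<partial>configs) = (\<integral>\<^sup>+R. ?h w R \<partial>tables)"
      by (intro nn_integral_splice) simp
  qed
  also have "\<dots> = (\<integral>\<^sup>+w. \<integral>\<^sup>+R. ?h w R \<partial>tables \<partial>P)"
  proof (rule nn_integral_distr[OF id])
    show "(\<lambda>w. \<integral>\<^sup>+R. ?h w R \<partial>tables) \<in> borel_measurable (distr P (F t) (\<lambda>w. w))"
      using T.borel_measurable_nn_integral_fst[OF past] by simp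
  qed
  also have "\<dots> = (\<integral>\<^sup>+R. f R \<partial>tables)"
    using Suc.IH by (simp add: run_history_def)
  finally show ?case .
qed

text \<open>The inclusion holds for every padding \<open>u\<close>, so the indicator of
  \<open>E\<close> is at most the average over \<open>u\<close> of the indicator of
  \<open>G\<close>.\<close>

lemma prob_le_measure_tables:
  assumes "E \<in> sets P" "G \<in> sets tables"
    and "\<And>w u. w \<in> E \<Longrightarrow> u \<in> space tables \<Longrightarrow> run_history t w u \<in> G"
  shows "prob E \<le> measure tables G"
proof -
  interpret T: prob_space tables by (rule prob_space_tables)
  have "emeasure P E = (\<integral>\<^sup>+w. indicator E w \<partial>P)" using assms(1) by simp
  also have "\<dots> \<le> (\<integral>\<^sup>+w. \<integral>\<^sup>+u. indicator G (run_history t w u) \<partial>tables \<partial>P)"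
  proof (rule nn_integral_mono)
    fix w
    show "indicator E w \<le> (\<integral>\<^sup>+u. indicator G (run_history t w u) \<partial>tables)"
    proof (cases "w \<in> E")
      case True
      have "(\<integral>\<^sup>+u. indicator G (run_history t w u) \<partial>tables) = (\<integral>\<^sup>+u. 1 \<partial>tables)"
        by (rule nn_integral_cong) (use assms(3) True in simp)
      then show ?thesis by (simp add: True T.emeasure_space_1)
    qed simp
  qed
  also have "\<dots> = (\<integral>\<^sup>+R. indicator G R \<partial>tables)"
    using assms(2) by (intro nn_integral_run_history) simp
  also have "\<dots> = emeasure tables G" using assms(2) by simp
  finally show ?thesis
    by (simp add: emeasure_eq_measure T.emeasure_eq_measure)
qed

text \<open>\<open>Rs s\<close> holds the values read from time \<open>s\<close> on. Each backward
  push is undone by an advance, and it restores the earlier state as head because the two states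
  agree off the resampled variables.\<close>

lemma past_states:
  assumes "w \<in> space P" "R \<in> space tables" "head R = X t w"
  shows "\<exists>Rs. Rs 0 = past t w R \<and> Rs t = R \<and> (\<forall>s\<le>t. head (Rs s) = X s w \<and> Rs s \<in> space tables)
    \<and> (\<forall>s<t. Rs (Suc s) = advance (resampled s w) (Rs s))"
  using assms(2,3)
proof (induction t arbitrary: R)
  case 0
  then show ?case by (intro exI[of _ "\<lambda>_. R"]) simp
next
  case (Suc t)
  let ?R = "splice (resampled t w) (X t w) R"
  have "?R \<in> space tables" using Suc.prems X_space[OF assms(1)] by (intro splice_space)
  moreover have "head ?R = X t w"
    using Suc.prems X_Suc[OF assms(1)] X_space[OF assms(1)]
    by (intro head_splice_override) auto
  ultimately obtain Rs where Rs: "Rs 0 = past t w ?R" "Rs t = ?R"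
      "\<forall>s\<le>t. head (Rs s) = X s w \<and> Rs s \<in> space tables"
      "\<forall>s<t. Rs (Suc s) = advance (resampled s w) (Rs s)"
    using Suc.IH by blast
  have "advance (resampled t w) (Rs t) = R" using Suc.prems Rs(2) by (simp add: advance_splice)
  then show ?case
    using Rs Suc.prems
    by (intro exI[of _ "Rs(Suc t := R)"]) (auto simp: less_Suc_eq le_Suc_eq)
qed

text \<open>The padding starts at the horizon \<open>t\<close>, but only the first \<open>m\<close>
  steps are read as a list of resamplings; they have to be genuine, so the run must not have stopped
  before \<open>m\<close>.\<close>

lemma run_history_states:
  assumes "w \<in> space P" "u \<in> space tables" "m \<le> t"
    and "\<And>s. s < m \<Longrightarrow> \<not> no_bad_event Bs (X s w)"
  shows "run_history t w u \<in> space tables"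
    and "run_ok (map (\<lambda>s. sel s w) [0..<m]) (run_history t w u)"
    and "head (run_table (map (\<lambda>s. sel s w) [0..<m]) (run_history t w u)) = X m w"
proof -
  let ?R = "splice {1..n} (X t w) u"
  have "?R \<in> space tables" "head ?R = X t w"
    using assms X_space by (auto intro: splice_space head_splice)
  then obtain Rs where Rs: "Rs 0 = run_history t w u"
      "\<And>s. s \<le> t \<Longrightarrow> head (Rs s) = X s w \<and> Rs s \<in> space tables"
      "\<And>s. s < t \<Longrightarrow> Rs (Suc s) = advance (resampled s w) (Rs s)"
    using past_states[OF assms(1)] unfolding run_history_def by metis
  show "run_history t w u \<in> space tables" using Rs(1) Rs(2)[of 0] by simp
  have *: "run_table (map (\<lambda>s. sel s w) [0..<m]) (run_history t w u) = Rs m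
    \<and> run_ok (map (\<lambda>s. sel s w) [0..<m]) (run_history t w u)"
    using assms(3,4)
  proof (induction m)
    case (Suc m)
    have "X m w \<in> outcomes (sel m w)" using Suc.prems sel_true[OF assms(1)] by blast
    moreover have "resampled m w = vars (sel m w)" using Suc.prems by (simp add: resampled_def)
    ultimately show ?case
      using Suc Rs(2)[of m] Rs(3)[of m] by (simp add: run_table_append run_ok_append)
  qed (simp add: Rs(1))
  then show "run_ok (map (\<lambda>s. sel s w) [0..<m]) (run_history t w u)" ..
  show "head (run_table (map (\<lambda>s. sel s w) [0..<m]) (run_history t w u)) = X m w"
    using * Rs(2)[OF assms(3)] by simp
qed

end

section \<open>The distribution at termination\<close>

text \<open>The product formula reduces the claim to empty index sets, where
  \<open>shearer_Q_empty_pos\<close> gives positivity for subfamilies.\<close>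

lemma shearer_mu_nonneg:
  assumes "finite Bs" "shearer_criterion \<Omega> Bs" "C \<subseteq> Bs" "J \<subseteq> C" "\<And>B. B \<in> Bs \<Longrightarrow> vars B \<noteq> {}"
  shows "0 \<le> shearer_mu \<Omega> C J"
proof (cases "stable J")
  case True
  have finC: "finite C" using assms(1,3) by (rule finite_subset[rotated])
  have pos: "0 < shearer_Q \<Omega> C' {}" if "C' \<subseteq> C" for C'
    using that assms(3) by (intro shearer_Q_empty_pos[OF assms(1,2)]) auto
  have "shearer_Q \<Omega> C J = (\<Prod>B\<in>J. pr \<Omega> B) * shearer_Q \<Omega> (C - neighbours J) {}"
    by (rule shearer_Q_stable[OF finC assms(4) True]) (use assms(3,5) in auto)
  moreover have "0 \<le> (\<Prod>B\<in>J. pr \<Omega> B)" by (rule prod_nonneg) (simp add: pr_def)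
  ultimately show ?thesis
    using pos[of C] pos[of "C - neighbours J"] by (simp add: shearer_mu_def)
qed (simp add: shearer_Q_unstable shearer_mu_def)

lemma sum_seq_weight_le_Psi:
  assumes "finite Bs" "shearer_criterion \<Omega> Bs" "C \<subseteq> Bs" "\<And>B. B \<in> Bs \<Longrightarrow> vars B \<noteq> {}"
  shows "(\<Sum>S\<in>stable_seqs C d (nbhd C E). seq_weight \<Omega> S) \<le> shearer_Psi \<Omega> C E"
  unfolding shearer_Psi_def
proof (rule sum_seq_weight_le)
  show "finite C" using assms(1,3) by (rule finite_subset[rotated])
  show "0 < shearer_Q \<Omega> C {}" using assms(1-3) by (rule shearer_Q_empty_pos)
  show "0 \<le> shearer_mu \<Omega> C J" if "J \<subseteq> C" for J
    using assms(1-3) that assms(4) by (rule shearer_mu_nonneg)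
qed (use assms(3,4) in \<open>auto simp: nbhd_def\<close>)

context resampling_table
begin

text \<open>A conditional probability of at least 1 means that \<open>B\<close> implies
  \<open>A\<close> up to a null set. Almost surely, such an event cannot be resampled while
  \<open>A\<close> is false.\<close>

lemma not_forcing_null:
  assumes "outcomes A \<in> sets configs" "outcomes B \<in> sets configs" "pr configs B \<noteq> 0"
    and "B \<in> Bs - not_forcing configs Bs A"
  shows "measure configs (outcomes B - outcomes A) = 0"
proof -
  interpret C: prob_space configs by (rule prob_space_configs)
  have "{x \<in> space configs. x \<in> outcomes A \<and> x \<in> outcomes B} = outcomes B \<inter> outcomes A"
    "{x \<in> space configs. x \<in> outcomes B} = outcomes B"
    using assms(1,2)[THEN sets.sets_into_space] by auto
  then have "1 \<le> measure configs (outcomes B \<inter> outcomes A) / measure configs (outcomes B)"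
    using assms(4) by (auto simp: not_forcing_def cond_prob_def not_less)
  moreover have "0 < measure configs (outcomes B)"
    using assms(3) by (simp add: pr_def zero_less_measure_iff)
  ultimately have "measure configs (outcomes B) \<le> measure configs (outcomes B \<inter> outcomes A)"
    by (simp add: le_divide_eq)
  then have "measure configs (outcomes B - outcomes A) \<le> 0"
    using C.finite_measure_Diff'[OF assms(2,1)] by simp
  then show ?thesis using measure_nonneg by (rule antisym)
qed

lemma sets_component:
  assumes "i \<in> {1..n}" "D \<in> sets (M i)"
  shows "{x \<in> space configs. x i \<in> D} \<in> sets configs"
  using measurable_component_singleton[OF assms(1), of M] assms(2) by measurable

text \<open>Entry \<open>(i, 1)\<close> is the value that \<open>i\<close> receives at its next
  resampling. It belongs to the head after all columns have been advanced once, so it is independent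
  of the whole current state, even if \<open>Z\<close> reads \<open>i\<close>.\<close>

lemma measure_config_table_entry:
  assumes "Z \<in> sets configs" "i \<in> {1..n}" "D \<in> sets (M i)"
  shows "{R \<in> space tables. head R \<in> Z \<and> R (i, 1) \<in> D} \<in> sets tables"
    and "measure tables {R \<in> space tables. head R \<in> Z \<and> R (i, 1) \<in> D}
      = measure configs Z * measure configs {x \<in> space configs. x i \<in> D}"
proof -
  let ?D = "{x \<in> space configs. x i \<in> D}"
  let ?G = "{R \<in> space tables. head R \<in> ?D}"
  have D: "?D \<in> sets configs" using assms(2,3) by (rule sets_component)
  then have G: "?G \<in> sets tables" by measurable
  have eq: "{R \<in> space tables. head R \<in> Z \<and> R (i, 1) \<in> D}
      = {R \<in> space tables. head R \<in> Z \<and> advance {1..n} R \<in> ?G}"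
    using assms(2)
    by (auto simp: head_apply advance_apply One_nat_def[symmetric] intro: head_space advance_space)
  show "{R \<in> space tables. head R \<in> Z \<and> R (i, 1) \<in> D} \<in> sets tables"
    unfolding eq using assms(1) G by measurable
  have "measure tables {R \<in> space tables. head R \<in> Z \<and> advance {1..n} R \<in> ?G}
    = measure configs Z * measure tables ?G"
  proof (rule measure_head_advance[OF assms(1) G])
    fix x y assume "x \<in> space configs" "y \<in> space configs" "\<And>v. v \<in> {1..n} \<Longrightarrow> x v = y v"
    then have "x = y" by (intro config_eqI) (auto simp: space_extensional)
    then show "x \<in> Z \<longleftrightarrow> y \<in> Z" by simp
  qed simp
  then show "measure tables {R \<in> space tables. head R \<in> Z \<and> R (i, 1) \<in> D}
      = measure configs Z * measure configs ?D"
    unfolding eq measure_head[OF D] .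
qed

end

section \<open>The first occurrence of \<open>A\<close> and the final estimate\<close>

context resampling_run
begin

lemma X_stopped:
  assumes "w \<in> space P" "no_bad_event Bs (X s w)" "s \<le> t"
  shows "X t w = X s w"
  using assms(3)
proof (induction t rule: dec_induct)
  case (step t)
  then show ?case using assms(1,2) by (simp add: X_step)
qed simp

text \<open>A statement about a single outcome: each alternative is a condition on the table alone,
  of a form whose measure has been computed. The horizon \<open>t\<close> bounds all lengths and so
  keeps the later unions finite.\<close>

lemma table_witness:
  fixes rank :: "'a event \<Rightarrow> nat"
  assumes w: "w \<in> space P" and u: "u \<in> space tables"
    and i: "i \<in> {1..n}" and C: "C \<subseteq> Bs"
    and A: "X t w i \<in> D"
  shows "head (run_history t w u) i \<in> D
    \<or> (\<exists>h. set h \<subseteq> Bs \<and> length h \<le> t \<and>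
          (\<exists>B\<in>Bs - C. head (run_table h (run_history t w u)) \<in> outcomes B \<and>
             head (run_table h (run_history t w u)) i \<notin> D))
    \<or> (\<exists>B\<in>{B \<in> C. i \<in> vars B}. \<exists>S\<in>stable_seqs C t (nbhd C B). seq_ok S (run_history t w u) \<and>
          head (seq_table S (run_history t w u))
            \<in> outcomes B - (\<Union>E\<in>{E \<in> {B \<in> C. i \<in> vars B}. rank E < rank B}. outcomes E) \<and>
          seq_table S (run_history t w u) (i, 1) \<in> D)"
    (is "?first \<or> ?null \<or> ?wit")
proof -
  let ?R = "run_history t w u"
  let ?h = "\<lambda>m. map (\<lambda>s. sel s w) [0..<m]"
  define \<tau> where "\<tau> = (LEAST s. X s w i \<in> D)"
  have \<tau>: "\<tau> \<le> t" "X \<tau> w i \<in> D"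
    unfolding \<tau>_def using A by (rule Least_le, rule LeastI)
  have before: "X s w i \<notin> D" if "s < \<tau>" for s
    using not_less_Least[of s "\<lambda>s. X s w i \<in> D"] that by (simp add: \<tau>_def)
  \<comment> \<open>A stopped run never changes, so \<open>A\<close> could not become true
    afterwards.\<close>
  have nonterm: "\<not> no_bad_event Bs (X s w)" if "s < \<tau>" for s
    using X_stopped[OF w, of s \<tau>] before[OF that] \<tau>(2) that by auto
  have states: "?R \<in> space tables" "run_ok (?h m) ?R" "head (run_table (?h m) ?R) = X m w"
    if "m \<le> \<tau>" for m
    using run_history_states[OF w u, of m t] nonterm that \<tau>(1) by auto
  have sel: "sel s w \<in> Bs" "X s w \<in> outcomes (sel s w)" if "s < \<tau>" for s
    using sel_true[OF w nonterm[OF that]] by auto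
  show ?thesis
  proof (cases \<tau>)
    case 0
    then have ?first using states(3)[of 0] \<tau>(2) by simp
    then show ?thesis ..
  next
    case (Suc m)
    show ?thesis
    proof (cases "\<forall>s\<le>m. sel s w \<in> C")
      \<comment> \<open>An event outside \<open>C\<close> was true while \<open>A\<close> was false.
        Listing the history up to that moment makes this a null event of the table for each fixed
        list.\<close>
      case False
      then obtain s where s: "s \<le> m" "sel s w \<notin> C" by blast
      have "s < \<tau>" using s(1) Suc by simp
      have "set (?h s) \<subseteq> Bs" using sel(1) \<open>s < \<tau>\<close> by auto
      moreover have "length (?h s) \<le> t" using \<open>s < \<tau>\<close> \<tau>(1) by simp
      moreover have "head (run_table (?h s) ?R) = X s w" using states(3)[of s] \<open>s < \<tau>\<close> by simp
      ultimately have ?null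
        using s(2) sel[OF \<open>s < \<tau>\<close>] before[OF \<open>s < \<tau>\<close>]
        by (intro exI[of _ "?h s"] conjI bexI[of _ "sel s w"]) auto
      then show ?thesis by blast
    next
      case True
      let ?B = "sel m w"
      have m: "m < \<tau>" using Suc by simp
      have iB: "i \<in> vars ?B"
      proof (rule ccontr)
        assume "i \<notin> vars ?B"
        then have "X \<tau> w i = X m w i"
          using X_Suc[OF w, of m] Suc nonterm[OF m] by (simp add: resampled_def override_on_def)
        then show False using \<tau>(2) before[OF m] by simp
      qed
      have "head (run_table (?h \<tau>) ?R) i = X \<tau> w i" using states(3)[of \<tau>] by simp
      \<comment> \<open>The resampling at step \<open>m\<close> advances column \<open>i\<close> by
        one, so the value that made \<open>A\<close> true had index 1 just before it. The witness is
        built from the first \<open>m\<close> resamplings only, without this last one.\<close>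
      then have entry: "run_table (?h m) ?R (i, 1) = X \<tau> w i"
        using i iB
        by (simp add: Suc run_table_append head_apply advance_apply One_nat_def[symmetric])
      have "\<exists>B\<in>{B \<in> C. i \<in> vars B}. \<exists>S\<in>stable_seqs C t (nbhd C B). seq_ok S ?R \<and>
        head (seq_table S ?R)
          \<in> outcomes B - (\<Union>E\<in>{E \<in> {B \<in> C. i \<in> vars B}. rank E < rank B}. outcomes E) \<and>
        (\<forall>k. seq_table S ?R (i, k) = run_table (?h m) ?R (i, k))"
      proof (rule minimal_witness)
        show "is_event n M E" if "E \<in> C" for E using that C is_event_Bs by blast
        show "finite {B \<in> C. i \<in> vars B}"
          by (rule finite_subset[OF _ finite_Bs]) (use C in blast)
        show "?R \<in> space tables" "run_ok (?h m) ?R" using states(1,2)[of m] m by auto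
        show "set (?h m) \<subseteq> C" using True by auto
        show "length (?h m) \<le> t" using m \<tau>(1) by simp
        show "?B \<in> {B \<in> C. i \<in> vars B}" using True iB by simp
        show "head (run_table (?h m) ?R) \<in> outcomes ?B"
          using states(3)[of m] m sel(2)[OF m] by simp
      qed auto
      then obtain B S where BS: "B \<in> {B \<in> C. i \<in> vars B}" "S \<in> stable_seqs C t (nbhd C B)"
          "seq_ok S ?R" "head (seq_table S ?R)
            \<in> outcomes B - (\<Union>E\<in>{E \<in> {B \<in> C. i \<in> vars B}. rank E < rank B}. outcomes E)"
          "\<forall>k. seq_table S ?R (i, k) = run_table (?h m) ?R (i, k)"
        by (elim bexE conjE) (rule that)
      have "seq_table S ?R (i, 1) \<in> D" using BS(5) entry \<tau>(2) by simp
      with BS(1-4) have ?wit by (intro bexI[of _ B] bexI[of _ S] conjI)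
      then show ?thesis by (intro disjI2)
    qed
  qed
qed

lemma pr_MT_le:
  assumes shearer: "shearer_criterion configs Bs"
    and i: "i \<in> {1..n}" and D: "D \<in> sets (M i)"
  defines "A \<equiv> Event {i} {x \<in> space configs. x i \<in> D}"
  defines "C \<equiv> not_forcing configs Bs A"
  defines "K \<equiv> {B \<in> C. i \<in> vars B}"
  shows "pr_MT P Bs X A \<le>
    pr configs A * (1 + (if K = {} then 0
       else measure configs (\<Union>B\<in>K. outcomes B) * (MAX B\<in>K. shearer_Psi configs C B)))"
    (is "_ \<le> ?bound")
proof -
  interpret \<Omega>: prob_space configs by (rule prob_space_configs)
  interpret T: prob_space tables by (rule prob_space_tables)
  have C: "C \<subseteq> Bs" by (auto simp: C_def not_forcing_def)
  have fin: "finite C" "finite K"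
    by (rule finite_subset[OF _ finite_Bs]; use C K_def in blast)+
  have vars: "vars B \<noteq> {}" if "B \<in> Bs" for B
    using finite_Bs shearer that is_event_Bs[OF that] prob_space_configs
    by (rule shearer_vars_nonempty)
  have evs: "outcomes B \<in> sets configs" if "B \<in> Bs" for B
    using is_event_Bs[OF that] by (simp add: is_event_def)
  have A: "outcomes A \<in> sets configs"
    using sets_component[OF i D] by (simp add: A_def)
  obtain rank :: "'a event \<Rightarrow> nat" where rank: "inj_on rank K"
    using finite_imp_inj_to_nat_seg[OF fin(2)] by blast
  define Z where "Z = (\<lambda>B. outcomes B - (\<Union>E\<in>{E \<in> K. rank E < rank B}. outcomes E))"
  have KBs: "K \<subseteq> Bs" using C K_def by blast
  have Z: "Z B \<in> sets configs" if "B \<in> K" for B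
    unfolding Z_def using that KBs evs fin(2) by (intro sets.Diff sets.finite_UN) auto
  define N where "N = (\<Union>B\<in>Bs - C. outcomes B - outcomes A)"
  have N: "N \<in> sets configs"
    unfolding N_def using finite_Bs evs A by (intro sets.finite_UN) auto
  have N0: "measure configs N = 0"
  proof -
    have "measure configs N \<le> (\<Sum>B\<in>Bs - C. measure configs (outcomes B - outcomes A))"
      unfolding N_def using finite_Bs evs A by (intro \<Omega>.finite_measure_subadditive_finite) auto
    also have "\<dots> = 0"
    proof (rule sum.neutral, rule ballI)
      fix B assume B: "B \<in> Bs - C"
      then show "measure configs (outcomes B - outcomes A) = 0"
        using A evs shearer_pr_pos[OF finite_Bs shearer, of B]
        by (intro not_forcing_null[where Bs = Bs]) (auto simp: C_def)
    qed
    finally show ?thesis using measure_nonneg by (rule antisym)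
  qed
  define G1 where "G1 = {R \<in> space tables. head R \<in> outcomes A}"
  define H where "H = (\<lambda>d. {h. set h \<subseteq> Bs \<and> length h \<le> d})"
  define G2 where "G2 = (\<lambda>h. {R \<in> space tables. head (run_table h R) \<in> N})"
  define W where "W = (\<lambda>B S. {R \<in> space tables. seq_ok S R \<and>
    seq_table S R \<in> {R \<in> space tables. head R \<in> Z B \<and> R (i, 1) \<in> D}})"
  \<comment> \<open>\<open>G d\<close> covers the three alternatives of \<open>table_witness\<close>
    at horizon \<open>d\<close>. All index sets are finite, and the bound on its measure will be
    free of \<open>d\<close>.\<close>
  define G where "G = (\<lambda>d. G1 \<union> (\<Union>h\<in>H d. G2 h) \<union> (\<Union>B\<in>K. \<Union>S\<in>stable_seqs C d (nbhd C B). W B S))"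
  have G1: "G1 \<in> sets tables" "measure tables G1 = pr configs A"
    unfolding G1_def using A measure_head[OF A] by (measurable, simp add: pr_def)
  have finH: "finite (H d)" for d
    unfolding H_def by (rule finite_lists_length_le[OF finite_Bs])
  have G2: "G2 h \<in> sets tables" "measure tables (G2 h) = 0" for h
  proof -
    have *: "{R \<in> space tables. head R \<in> N} \<in> sets tables" using N by measurable
    have "G2 h = {R \<in> space tables. run_table h R \<in> {R \<in> space tables. head R \<in> N}}"
      unfolding G2_def by (auto intro: run_table_space)
    then show "measure tables (G2 h) = 0"
      using measure_run_table[OF *] measure_head[OF N] N0 by (simp only:)
    show "G2 h \<in> sets tables" unfolding G2_def using N by measurable
  qed
  have stable_seqD: "stable_seq C S" if "S \<in> stable_seqs C d (nbhd C B)" for S d B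
    using that by (simp add: stable_seqs_def)
  have W: "W B S \<in> sets tables"
      "measure tables (W B S) = seq_weight configs S * (measure configs (Z B) * pr configs A)"
    if "B \<in> K" "stable_seq C S" for B S
  proof -
    note entry = measure_config_table_entry[OF Z[OF that(1)] i D]
    have ev: "\<And>B. B \<in> C \<Longrightarrow> is_event n M B" using C is_event_Bs by blast
    have "{R \<in> space tables. seq_ok S R} \<in> sets tables"
      by (rule measurable_seq_ok[OF that(2) fin(1) ev])
    moreover have "{R \<in> space tables. seq_table S R \<in> {R \<in> space tables. head R \<in> Z B \<and> R (i, 1) \<in> D}} \<in> sets tables"
      using entry(1) by measurable
    ultimately show "W B S \<in> sets tables"
      unfolding W_def by (rule sets.sets_Collect_conj[rotated])
    show "measure tables (W B S) = seq_weight configs S * (measure configs (Z B) * pr configs A)"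
      unfolding W_def using measure_seq_ok[OF that(2) fin(1) ev entry(1)] entry(2)
      by (simp add: pr_def A_def)
  qed
  have WW: "(\<Union>S\<in>stable_seqs C d (nbhd C B). W B S) \<in> sets tables" if "B \<in> K" for B d
    using W(1)[OF that stable_seqD] finite_stable_seqs[OF fin(1)] by (intro sets.finite_UN) auto
  have GW: "(\<Union>B\<in>K. \<Union>S\<in>stable_seqs C d (nbhd C B). W B S) \<in> sets tables" for d
    using fin(2) WW by (rule sets.finite_UN)
  have GN: "(\<Union>h\<in>H d. G2 h) \<in> sets tables" for d
    using finH G2(1) by (rule sets.finite_UN)
  have G: "G d \<in> sets tables" for d
    unfolding G_def using G1(1) GN GW by (intro sets.Un)
  have G_le: "measure tables (G d) \<le> ?bound" for d
  proof -
    have WB: "measure tables (\<Union>S\<in>stable_seqs C d (nbhd C B). W B S)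
      \<le> shearer_Psi configs C B * (measure configs (Z B) * pr configs A)" if B: "B \<in> K" for B
    proof -
      have "measure tables (\<Union>S\<in>stable_seqs C d (nbhd C B). W B S)
        \<le> (\<Sum>S\<in>stable_seqs C d (nbhd C B). measure tables (W B S))"
        using W(1)[OF B stable_seqD] finite_stable_seqs[OF fin(1)]
        by (intro T.finite_measure_subadditive_finite) auto
      also have "\<dots> = (\<Sum>S\<in>stable_seqs C d (nbhd C B). seq_weight configs S)
          * (measure configs (Z B) * pr configs A)"
        using W(2)[OF B stable_seqD] by (simp add: sum_distrib_right)
      also have "\<dots> \<le> shearer_Psi configs C B * (measure configs (Z B) * pr configs A)"
        by (intro mult_right_mono sum_seq_weight_le_Psi[OF finite_Bs shearer C vars])
          (simp_all add: pr_def)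
      finally show ?thesis .
    qed
    have "measure tables (\<Union>h\<in>H d. G2 h) \<le> (\<Sum>h\<in>H d. measure tables (G2 h))"
      using finH G2(1) by (intro T.finite_measure_subadditive_finite) auto
    then have null: "measure tables (\<Union>h\<in>H d. G2 h) \<le> 0" by (simp add: G2(2))
    have wit: "measure tables (\<Union>B\<in>K. \<Union>S\<in>stable_seqs C d (nbhd C B). W B S)
      \<le> pr configs A * (if K = {} then 0
       else measure configs (\<Union>B\<in>K. outcomes B) * (MAX B\<in>K. shearer_Psi configs C B))"
    proof (cases "K = {}")
      case False
      let ?m = "MAX B\<in>K. shearer_Psi configs C B"
      have disj: "disjoint_family_on Z K"
        unfolding disjoint_family_on_def
      proof (intro ballI impI)
        fix B E assume BE: "B \<in> K" "E \<in> K" "B \<noteq> E"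
        then have "rank B \<noteq> rank E" using rank by (auto dest: inj_onD)
        then show "Z B \<inter> Z E = {}" using BE by (auto simp: Z_def neq_iff)
      qed
      have "(\<Sum>B\<in>K. measure configs (Z B)) = measure configs (\<Union>B\<in>K. Z B)"
        using fin(2) Z disj by (intro \<Omega>.finite_measure_finite_Union[symmetric]) auto
      also have "\<dots> \<le> measure configs (\<Union>B\<in>K. outcomes B)"
        using fin(2) evs KBs
        by (intro \<Omega>.finite_measure_mono sets.finite_UN) (auto simp: Z_def)
      finally have sumZ: "(\<Sum>B\<in>K. measure configs (Z B)) \<le> measure configs (\<Union>B\<in>K. outcomes B)" .
      obtain B0 where "B0 \<in> K" using False by blast
      have "0 \<le> shearer_Psi configs C B0"
        unfolding shearer_Psi_def using shearer_mu_nonneg[OF finite_Bs shearer C _ vars]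
        by (intro sum_nonneg) (auto simp: nbhd_def)
      also have "\<dots> \<le> ?m" using fin(2) \<open>B0 \<in> K\<close> by simp
      finally have m0: "0 \<le> ?m" .
      have "measure tables (\<Union>B\<in>K. \<Union>S\<in>stable_seqs C d (nbhd C B). W B S)
        \<le> (\<Sum>B\<in>K. measure tables (\<Union>S\<in>stable_seqs C d (nbhd C B). W B S))"
        using fin(2) WW by (intro T.finite_measure_subadditive_finite) auto
      also have "\<dots> \<le> (\<Sum>B\<in>K. shearer_Psi configs C B * (measure configs (Z B) * pr configs A))"
        by (intro sum_mono WB)
      also have "\<dots> \<le> (\<Sum>B\<in>K. ?m * (measure configs (Z B) * pr configs A))"
        using fin(2) by (intro sum_mono mult_right_mono) (auto simp: pr_def)
      also have "\<dots> = (?m * pr configs A) * (\<Sum>B\<in>K. measure configs (Z B))"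
        by (simp add: sum_distrib_left mult_ac)
      also have "\<dots> \<le> (?m * pr configs A) * measure configs (\<Union>B\<in>K. outcomes B)"
        using sumZ m0 by (intro mult_left_mono mult_nonneg_nonneg) (auto simp: pr_def)
      finally show ?thesis using False by (simp add: mult_ac)
    qed simp
    have "measure tables (G d) \<le> measure tables (G1 \<union> (\<Union>h\<in>H d. G2 h))
      + measure tables (\<Union>B\<in>K. \<Union>S\<in>stable_seqs C d (nbhd C B). W B S)"
      unfolding G_def using G1(1) GN GW by (intro measure_Un_le sets.Un)
    also have "measure tables (G1 \<union> (\<Union>h\<in>H d. G2 h)) \<le> measure tables G1 + measure tables (\<Union>h\<in>H d. G2 h)"
      using G1(1) GN by (rule measure_Un_le)
    finally show ?thesis using null wit by (simp add: G1(2) distrib_left)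
  qed
  define E where "E = (\<lambda>t. {w \<in> space P. no_bad_event Bs (X t w) \<and> X t w \<in> outcomes A})"
  have E: "E t \<in> events" for t
  proof -
    have "X t \<in> P \<rightarrow>\<^sub>M configs" by (rule measurable_from_subalg[OF subalgebra_F X_adapted])
    moreover have "{x \<in> space configs. no_bad_event Bs x} \<inter> outcomes A \<in> sets configs"
      using sets_no_bad_event A by (rule sets.Int)
    ultimately have "X t -` ({x \<in> space configs. no_bad_event Bs x} \<inter> outcomes A) \<inter> space P \<in> events"
      by (rule measurable_sets)
    moreover have "X t -` ({x \<in> space configs. no_bad_event Bs x} \<inter> outcomes A) \<inter> space P = E t"
      using X_space by (auto simp: E_def)
    ultimately show ?thesis by simp
  qed
  have E_le: "prob (E t) \<le> ?bound" for t
  proof -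
    have "prob (E t) \<le> measure tables (G t)"
    proof (rule prob_le_measure_tables[OF E G])
      fix w u assume w: "w \<in> E t" and u: "u \<in> space tables"
      have wP: "w \<in> space P" and XD: "X t w i \<in> D" using w by (auto simp: E_def A_def)
      let ?R = "run_history t w u"
      have R: "?R \<in> space tables" using run_history_states(1)[OF wP u, of 0 t] by simp
      from table_witness[OF wP u i C XD, of rank]
      show "?R \<in> G t"
      proof (elim disjE)
        assume "head ?R i \<in> D"
        then show ?thesis using R by (auto simp: G_def G1_def A_def intro: head_space)
      next
        assume "\<exists>h. set h \<subseteq> Bs \<and> length h \<le> t \<and> (\<exists>B\<in>Bs - C. head (run_table h ?R) \<in> outcomes B \<and>
             head (run_table h ?R) i \<notin> D)"
        then obtain h B where hB: "set h \<subseteq> Bs" "length h \<le> t" "B \<in> Bs - C"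
            "head (run_table h ?R) \<in> outcomes B" "head (run_table h ?R) i \<notin> D" by blast
        have "h \<in> H t" using hB by (simp add: H_def)
        moreover have "head (run_table h ?R) \<in> N"
          unfolding N_def using hB by (intro UN_I[of B]) (auto simp: A_def)
        then have "?R \<in> G2 h" using R by (simp add: G2_def)
        ultimately show ?thesis by (auto simp: G_def)
      next
        assume "\<exists>B\<in>{B \<in> C. i \<in> vars B}. \<exists>S\<in>stable_seqs C t (nbhd C B). seq_ok S ?R \<and>
          head (seq_table S ?R)
            \<in> outcomes B - (\<Union>E\<in>{E \<in> {B \<in> C. i \<in> vars B}. rank E < rank B}. outcomes E) \<and>
          seq_table S ?R (i, 1) \<in> D"
        then obtain B S where BS: "B \<in> K" "S \<in> stable_seqs C t (nbhd C B)" "seq_ok S ?R"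
            "head (seq_table S ?R) \<in> Z B" "seq_table S ?R (i, 1) \<in> D"
          unfolding K_def[symmetric] Z_def by blast
        have "?R \<in> W B S" using BS R seq_table_space[OF R] by (simp add: W_def)
        then show ?thesis using BS(1,2) unfolding G_def by blast
      qed
    qed
    also have "\<dots> \<le> ?bound" by (rule G_le)
    finally show ?thesis .
  qed
  \<comment> \<open>A stopped run keeps its state, so continuity from below carries the uniform
    bound over to the union of all times.\<close>
  have "incseq E"
  proof (rule incseq_SucI, rule subsetI)
    fix t w assume w: "w \<in> E t"
    then have "X (Suc t) w = X t w" by (simp add: E_def X_step)
    then show "w \<in> E (Suc t)" using w by (simp add: E_def)
  qed
  then have "(\<lambda>t. prob (E t)) \<longlonglongrightarrow> prob (\<Union>t. E t)"
    using E by (intro finite_Lim_measure_incseq) auto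
  then have "prob (\<Union>t. E t) \<le> ?bound"
    by (rule LIMSEQ_le_const2) (use E_le in auto)
  moreover have "(\<Union>t. E t) = {w \<in> space P. \<exists>t. no_bad_event Bs (X t w) \<and> X t w \<in> outcomes A}"
    by (auto simp: E_def)
  ultimately show ?thesis by (simp add: pr_MT_def)
qed

end

theorem corollary4p5:
  fixes n i :: nat
    and M :: "nat \<Rightarrow> 'a measure"
    and Bs B' :: "'a event set"
    and D :: "'a set"
    and A :: "'a event"
    and P :: "'w measure"
    and F :: "nat \<Rightarrow> 'w measure"
    and X Y :: "nat \<Rightarrow> 'w \<Rightarrow> nat \<Rightarrow> 'a"
    and sel :: "nat \<Rightarrow> 'w \<Rightarrow> 'a event"
    and \<Omega> :: "(nat \<Rightarrow> 'a) measure"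
  defines "\<Omega> \<equiv> config_space n M"
    and "A \<equiv> Event {i} {x \<in> space \<Omega>. x i \<in> D}"
    and "B' \<equiv> {B \<in> not_forcing \<Omega> Bs A. i \<in> vars B}"
  assumes "\<And>j. j \<in> {1..n} \<Longrightarrow> prob_space (M j)"
    and "finite Bs"
    and "\<And>B. B \<in> Bs \<Longrightarrow> is_event n M B"
    and "shearer_criterion \<Omega> Bs"
    and "i \<in> {1..n}"
    and "D \<in> sets (M i)"
    and "moser_tardos_run P F n M Bs X sel Y"
  shows "pr_MT P Bs X A \<le>
           pr \<Omega> A * (1 + (if B' = {} then 0
                          else measure \<Omega> (\<Union>B\<in>B'. outcomes B)
                                 * (MAX B\<in>B'. shearer_Psi \<Omega> (not_forcing \<Omega> Bs A) B)))"
proof -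
  interpret resampling_run P F n M Bs X sel Y
    by (intro resampling_run.intro resampling_table.intro resampling_run_axioms.intro) (fact assms)+
  show ?thesis
    using assms(7-9) unfolding B'_def A_def \<Omega>_def by (rule pr_MT_le)
qed

end
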